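(* Let $\mathcal{C}$ be an arbitrary set of corner minors of $M$. Denote by $H_1$ and $V_1$ the maximal horizontal and the maximal vertical interval of $\mathcal{C}$ containing the vertex $x_{11}$, respectively, and by $h_1,v_1$ the corresponding vertices of $G(\mathcal{C})$. Then $I(\mathcal{C})$ is a radical ideal if and only if the induced subgraph $G(\mathcal{C})\setminus\{v_1,h_1\}$ of $G(\mathcal{C})$ contains no cycle. Moreover, if $G(\mathcal{C})\setminus\{v_1,h_1\}$ contains no cycle, then $\bigcap_{W\in\mathcal{W}}P_W(\mathcal{C})$ is the primary decomposition of $I(\mathcal{C})$.
   Context: Let $K$ be a field and $M=(x_{ij})$ an $m\times n$ matrix of indeterminates. A 2-minor is $\delta=[a_1,a_2|b_1,b_2]$ with $a_1<a_2$, $b_1<b_2$; $f_\delta=x_{a_1b_1}x_{a_2b_2}-x_{a_1b_2}x_{a_2b_1}$. Its vertex set is $V(\delta)=\{x_{a_1b_1},x_{a_1b_2},x_{a_2b_1},x_{a_2b_2}\}$; its edges are the horizontal edges $\{x_{a_1b_1},x_{a_1b_2}\}$, $\{x_{a_2b_1},x_{a_2b_2}\}$ and the vertical edges $\{x_{a_1b_1},x_{a_2b_1}\}$, $\{x_{a_1b_2},x_{a_2b_2}\}$. It is a corner minor if $a_1=1$ and $b_1=1$. For a set $\mathcal{C}$ of 2-minors, $V(\mathcal{C})$ and $E(\mathcal{C})$ are the unions of the vertex sets and edge sets of its members, $S=K[x_{ij}\mid x_{ij}\in V(\mathcal{C})]$, and $I(\mathcal{C})=(f_\delta\mid\delta\in\mathcal{C})\subset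 S$. A vertical interval of $\mathcal{C}$ is a set of vertices of $V(\mathcal{C})$ lying in one column of $M$ such that any two of them are joined by a path of vertical edges of $\mathcal{C}$; it is maximal if it is not strictly contained in another vertical interval. (Maximal) horizontal intervals are defined analogously with rows and horizontal edges. Let $V_1,\dots,V_p$ and $H_1,\dots,H_q$ be the maximal vertical and maximal horizontal intervals of $\mathcal{C}$. $G(\mathcal{C})$ is the bipartite graph with vertices $v_1,\dots,v_p,h_1,\dots,h_q$ and edges $\{h_i,v_j\}$ for $H_i\cap V_j\ne\emptyset$; in that case $H_i\cap V_j$ is a single vertex, denoted $x_{a_i b_j}$. For a cycle $\sigma:h_{i_1},v_{j_1},\dots,h_{i_r},v_{j_r}$ ($r\ge2$) in $G(\mathcal{C})$ put $f_\sigma=\prod_{k=1}^r x_{a_{i_k},b_{j_k}}-\prod_{k=1}^r x_{a_{i_{k+1}},b_{j_k}}$ with $i_{r+1}=i_1$. $J_{\mathcal{C}}$ is the ideal generated by all $f_\sigma$, $\sigma$ a cycle in $G(\mathcal{C})$. For $\mathcal{D}\subset\mathcal{C}$, $J_{\mathcal{D}}$ is formed from the intervals of $\mathcal{D}$ and regarded as an ideal of $S$ by extension (zero if $\mathcal{D}=\emptyset$). A subset $W\subset V(\mathcal{C})$ is admissible if for each $\delta\in\mathcal{C}$ either $W\cap V(\delta)=\emptyset$ or $W\cap V(\delta)$ contains an edge of $\delta$. For admissible $W$, $P_W(\mathcal{C})=(x_{ij}\mid x_{ij}\in W)+J_{\mathcal{C}'}\subset S$ with $\mathcal{C}'=\{\delta\in\mathcal{C}\mid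 V(\delta)\cap W=\emptyset\}$. $\mathcal{W}$ denotes the set of all admissible $W\subset V(\mathcal{C})$ such that $P_W(\mathcal{C})$ is a minimal prime of $I(\mathcal{C})$. *)

theory Defs
  imports "HOL-Algebra.Ideal" "HOL-Library.Poly_Mapping"
begin

section \<open>Ideals\<close>

definition radical_of :: "('a, 'b) ring_scheme \<Rightarrow> 'a set \<Rightarrow> 'a set" where
  "radical_of R I = {x \<in> carrier R. \<exists>n::nat. n > 0 \<and> x [^]\<^bsub>R\<^esub> n \<in> I}"

definition radical_ideal :: "('a, 'b) ring_scheme \<Rightarrow> 'a set \<Rightarrow> bool" where
  "radical_ideal R I \<longleftrightarrow> ideal I R \<and> radical_of R I = I"

definition minimal_prime :: "('a, 'b) ring_scheme \<Rightarrow> 'a set \<Rightarrow> 'a set \<Rightarrow> bool" where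
  "minimal_prime R I P \<longleftrightarrow> primeideal P R \<and> I \<subseteq> P \<and>
     (\<forall>Q. primeideal Q R \<and> I \<subseteq> Q \<and> Q \<subseteq> P \<longrightarrow> Q = P)"

definition primary_ideal :: "('a, 'b) ring_scheme \<Rightarrow> 'a set \<Rightarrow> bool" where
  "primary_ideal R Q \<longleftrightarrow> ideal Q R \<and> Q \<noteq> carrier R \<and>
     (\<forall>a\<in>carrier R. \<forall>b\<in>carrier R. a \<otimes>\<^bsub>R\<^esub> b \<in> Q \<longrightarrow> a \<in> Q \<or> b \<in> radical_of R Q)"

text \<open>The finite family \<open>Q\<close> indexed by \<open>A\<close> is an irredundant primary decomposition of \<open>I\<close>
  with pairwise distinct radicals. Intersecting with the carrier makes the empty intersection
  the unit ideal.\<close>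

definition primary_decomposition ::
    "('a, 'b) ring_scheme \<Rightarrow> 'a set \<Rightarrow> 'i set \<Rightarrow> ('i \<Rightarrow> 'a set) \<Rightarrow> bool" where
  "primary_decomposition R I A Q \<longleftrightarrow>
     finite A \<and> (\<forall>i\<in>A. primary_ideal R (Q i)) \<and>
     carrier R \<inter> (\<Inter>i\<in>A. Q i) = I \<and>
     inj_on (\<lambda>i. radical_of R (Q i)) A \<and>
     (\<forall>i\<in>A. carrier R \<inter> (\<Inter>j\<in>A - {i}. Q j) \<noteq> I)"

section \<open>Polynomial rings\<close>

text \<open>A polynomial is a finitely supported function from monomials (finitely supported
  exponent vectors) to coefficients. All polynomial rings over the field \<open>'k\<close> in
  variables of type \<open>'x\<close> are subrings of one type.\<close>

type_synonym ('x, 'k) mpoly = "('x \<Rightarrow>\<^sub>0 nat) \<Rightarrow>\<^sub>0 'k"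

definition Var :: "'x \<Rightarrow> ('x, 'k::field) mpoly" where
  "Var x = Poly_Mapping.single (Poly_Mapping.single x 1) 1"

definition mpoly_ring :: "'x set \<Rightarrow> ('x, 'k::field) mpoly ring" where
  "mpoly_ring V =
     \<lparr>carrier = {p. \<forall>t \<in> Poly_Mapping.keys p. Poly_Mapping.keys t \<subseteq> V},
      mult = (*), one = 1, zero = 0, add = (+)\<rparr>"

lemma cring_mpoly_ring: "cring (mpoly_ring V :: ('x, 'k::field) mpoly ring)"
proof (rule cringI)
  let ?R = "mpoly_ring V :: ('x, 'k) mpoly ring"
  show "abelian_group ?R"
  proof (rule abelian_groupI)
    fix p q assume "p \<in> carrier ?R" "q \<in> carrier ?R"
    then show "p \<oplus>\<^bsub>?R\<^esub> q \<in> carrier ?R"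
      using Poly_Mapping.keys_add[of p q] by (fastforce simp: mpoly_ring_def)
  next
    fix p assume "p \<in> carrier ?R"
    then show "\<exists>q\<in>carrier ?R. q \<oplus>\<^bsub>?R\<^esub> p = \<zero>\<^bsub>?R\<^esub>"
      by (intro bexI[of _ "- p"]) (auto simp: mpoly_ring_def)
  qed (auto simp: mpoly_ring_def algebra_simps)
  show "Group.comm_monoid ?R"
  proof (rule comm_monoidI)
    fix p q assume pq: "p \<in> carrier ?R" "q \<in> carrier ?R"
    have "Poly_Mapping.keys t \<subseteq> V" if "t \<in> Poly_Mapping.keys (p * q)" for t
    proof -
      from that keys_mult[of p q] obtain a b where
        ab: "t = a + b" "a \<in> Poly_Mapping.keys p" "b \<in> Poly_Mapping.keys q" by blast
      then show ?thesis
        using pq Poly_Mapping.keys_add[of a b] by (fastforce simp: mpoly_ring_def)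
    qed
    then show "p \<otimes>\<^bsub>?R\<^esub> q \<in> carrier ?R" by (simp add: mpoly_ring_def)
  qed (auto simp: mpoly_ring_def algebra_simps)
qed (auto simp: mpoly_ring_def algebra_simps)

section \<open>Two-minors\<close>

text \<open>The pair \<open>(i, j)\<close> stands for the indeterminate \<open>x\<^sub>i\<^sub>j\<close>, with indices starting at 1;
  \<open>(a\<^sub>1, a\<^sub>2, b\<^sub>1, b\<^sub>2)\<close> stands for the minor \<open>[a\<^sub>1,a\<^sub>2|b\<^sub>1,b\<^sub>2]\<close>.\<close>

type_synonym vertex = "nat \<times> nat"
type_synonym minor = "nat \<times> nat \<times> nat \<times> nat"

definition two_minors :: "nat \<Rightarrow> nat \<Rightarrow> minor set" where
  "two_minors m n =
     {(a1, a2, b1, b2). 1 \<le> a1 \<and> a1 < a2 \<and> a2 \<le> m \<and> 1 \<le> b1 \<and> b1 < b2 \<and> b2 \<le> n}"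

fun corner_minor :: "minor \<Rightarrow> bool" where
  "corner_minor (a1, a2, b1, b2) \<longleftrightarrow> a1 = 1 \<and> b1 = 1"

fun minor_poly :: "minor \<Rightarrow> (vertex, 'k::field) mpoly" where
  "minor_poly (a1, a2, b1, b2) =
     Var (a1, b1) * Var (a2, b2) - Var (a1, b2) * Var (a2, b1)"

fun minor_verts :: "minor \<Rightarrow> vertex set" where
  "minor_verts (a1, a2, b1, b2) = {(a1, b1), (a1, b2), (a2, b1), (a2, b2)}"

fun minor_hedges :: "minor \<Rightarrow> vertex set set" where
  "minor_hedges (a1, a2, b1, b2) = {{(a1, b1), (a1, b2)}, {(a2, b1), (a2, b2)}}"

fun minor_vedges :: "minor \<Rightarrow> vertex set set" where
  "minor_vedges (a1, a2, b1, b2) = {{(a1, b1), (a2, b1)}, {(a1, b2), (a2, b2)}}"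

definition minor_edges :: "minor \<Rightarrow> vertex set set" where
  "minor_edges d = minor_hedges d \<union> minor_vedges d"

definition verts_of :: "minor set \<Rightarrow> vertex set" where
  "verts_of C = (\<Union>d\<in>C. minor_verts d)"

definition hedges_of :: "minor set \<Rightarrow> vertex set set" where
  "hedges_of C = (\<Union>d\<in>C. minor_hedges d)"

definition vedges_of :: "minor set \<Rightarrow> vertex set set" where
  "vedges_of C = (\<Union>d\<in>C. minor_vedges d)"

definition minor_ring :: "minor set \<Rightarrow> (vertex, 'k::field) mpoly ring" where
  "minor_ring C = mpoly_ring (verts_of C)"

definition minor_ideal :: "minor set \<Rightarrow> (vertex, 'k::field) mpoly set" where
  "minor_ideal C = Idl\<^bsub>minor_ring C\<^esub> (minor_poly ` C)"

section \<open>Intervals and the bipartite graph\<close>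

definition path_connected_by :: "vertex set set \<Rightarrow> vertex \<Rightarrow> vertex \<Rightarrow> bool" where
  "path_connected_by E x y \<longleftrightarrow> (x, y) \<in> {(u, v). {u, v} \<in> E}\<^sup>*"

text \<open>Intervals are required to be nonempty. This matters only for \<open>C = {}\<close>, which then has
  no intervals at all.\<close>

definition horizontal_interval :: "minor set \<Rightarrow> vertex set \<Rightarrow> bool" where
  "horizontal_interval C H \<longleftrightarrow> H \<noteq> {} \<and> H \<subseteq> verts_of C \<and> (\<exists>a. \<forall>x\<in>H. fst x = a) \<and>
     (\<forall>x\<in>H. \<forall>y\<in>H. path_connected_by (hedges_of C) x y)"

definition vertical_interval :: "minor set \<Rightarrow> vertex set \<Rightarrow> bool" where
  "vertical_interval C V \<longleftrightarrow> V \<noteq> {} \<and> V \<subseteq> verts_of C \<and> (\<exists>b. \<forall>x\<in>V. snd x = b) \<and>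
     (\<forall>x\<in>V. \<forall>y\<in>V. path_connected_by (vedges_of C) x y)"

definition max_horizontal_intervals :: "minor set \<Rightarrow> vertex set set" where
  "max_horizontal_intervals C =
     {H. horizontal_interval C H \<and> \<not> (\<exists>H'. horizontal_interval C H' \<and> H \<subset> H')}"

definition max_vertical_intervals :: "minor set \<Rightarrow> vertex set set" where
  "max_vertical_intervals C =
     {V. vertical_interval C V \<and> \<not> (\<exists>V'. vertical_interval C V' \<and> V \<subset> V')}"

text \<open>A simple undirected graph is a pair of a vertex set and a set of two-element edges.\<close>

type_synonym 'v ugraph = "'v set \<times> 'v set set"

definition is_cycle :: "'v ugraph \<Rightarrow> 'v list \<Rightarrow> bool" where
  "is_cycle G c \<longleftrightarrow> 3 \<le> length c \<and> distinct c \<and> set c \<subseteq> fst G \<and>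
     (\<forall>i < length c. {c ! i, c ! ((i + 1) mod length c)} \<in> snd G)"

definition delete_verts :: "'v ugraph \<Rightarrow> 'v set \<Rightarrow> 'v ugraph" where
  "delete_verts G X = (fst G - X, {e \<in> snd G. e \<inter> X = {}})"

text \<open>\<open>Inl H\<close> is the graph vertex belonging to the horizontal interval \<open>H\<close>, and \<open>Inr V\<close> the one
  belonging to the vertical interval \<open>V\<close>.\<close>

definition interval_graph :: "minor set \<Rightarrow> (vertex set + vertex set) ugraph" where
  "interval_graph C =
     (Inl ` max_horizontal_intervals C \<union> Inr ` max_vertical_intervals C,
      {{Inl H, Inr V} | H V. H \<in> max_horizontal_intervals C \<and>
         V \<in> max_vertical_intervals C \<and> H \<inter> V \<noteq> {}})"

text \<open>The binomial of the cycle \<open>hs ! 0, vs ! 0, hs ! 1, vs ! 1, \<dots>\<close>. Along a cycle all the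
  intersections below are singletons.\<close>

definition cycle_poly :: "vertex set list \<Rightarrow> vertex set list \<Rightarrow> (vertex, 'k::field) mpoly" where
  "cycle_poly hs vs =
     (\<Prod>k<length hs. Var (the_elem (hs ! k \<inter> vs ! k))) -
     (\<Prod>k<length hs. Var (the_elem (hs ! ((k + 1) mod length hs) \<inter> vs ! k)))"

definition cycle_polys :: "minor set \<Rightarrow> (vertex, 'k::field) mpoly set" where
  "cycle_polys D = {cycle_poly hs vs | hs vs. length hs = length vs \<and>
     is_cycle (interval_graph D) (splice (map Inl hs) (map Inr vs))}"

text \<open>\<open>cycle_ideal C D\<close> is the extension of \<open>J\<^sub>D\<close> to the ring \<open>minor_ring C\<close>.\<close>

definition cycle_ideal :: "minor set \<Rightarrow> minor set \<Rightarrow> (vertex, 'k::field) mpoly set" where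
  "cycle_ideal C D = Idl\<^bsub>minor_ring C\<^esub> (cycle_polys D)"

section \<open>Admissible sets\<close>

definition admissible :: "minor set \<Rightarrow> vertex set \<Rightarrow> bool" where
  "admissible C W \<longleftrightarrow> W \<subseteq> verts_of C \<and>
     (\<forall>d\<in>C. W \<inter> minor_verts d = {} \<or> (\<exists>e\<in>minor_edges d. e \<subseteq> W \<inter> minor_verts d))"

definition admissible_ideal :: "minor set \<Rightarrow> vertex set \<Rightarrow> (vertex, 'k::field) mpoly set" where
  "admissible_ideal C W =
     Idl\<^bsub>minor_ring C\<^esub> (Var ` W) <+>\<^bsub>minor_ring C\<^esub>
     cycle_ideal C {d \<in> C. minor_verts d \<inter> W = {}}"

text \<open>The set of admissible \<open>W\<close> giving minimal primes; the type argument fixes the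
  coefficient field.\<close>

definition minimal_admissible :: "'k::field itself \<Rightarrow> minor set \<Rightarrow> vertex set set" where
  "minimal_admissible K C = {W. admissible C W \<and>
     minimal_prime (minor_ring C) (minor_ideal C) (admissible_ideal C W :: (vertex, 'k) mpoly set)}"

end

theory Submission
  imports Defs "HOL-Library.Product_Lexorder"
begin

text \<open>Sending \<open>x\<^sub>a\<^sub>b\<close> to the product of a row variable and a column variable defines a prime ideal
  \<open>J\<close>, which is generated by the binomials of the cycles of \<open>G(C)\<close>. If every cycle passes through
  \<open>h\<^sub>1\<close> or \<open>v\<^sub>1\<close>, telescoping along the cycle gives \<open>x\<^sub>1\<^sub>1 J \<subseteq> I(C)\<close>. The intersection of the
  monomial primes \<open>P\<^sub>W\<close> with \<open>W\<close> admissible and \<open>x\<^sub>1\<^sub>1 \<in> W\<close> is \<open>(x\<^sub>1\<^sub>1) + I(C)\<close>, so by the modular law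
  its intersection with \<open>J\<close> is \<open>I(C) + x\<^sub>1\<^sub>1 J = I(C)\<close>. Conversely, for a cycle \<open>\<sigma>\<close> avoiding
  \<open>h\<^sub>1\<close> and \<open>v\<^sub>1\<close>, a power of \<open>x\<^sub>1\<^sub>1 f\<^sub>\<sigma>\<close> lies in \<open>I(C)\<close>, but \<open>x\<^sub>1\<^sub>1 f\<^sub>\<sigma>\<close> itself does not.\<close>

section \<open>Polynomial rings and monomial maps\<close>

text \<open>Modulo I(C) the product x_11 x_ab equals x_a1 x_1b at every vertex (a, b), so a monomial
  with enough factors x_11 remembers only its rows and its columns, not how they are paired. Hence
  some power of x_11 multiplies each f_sigma into I(C). The obstacle to radicality is that a single
  factor x_11 has to suffice. It does when the cycle meets row 1 or column 1: a border variable x_1b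
  or x_a1 can then be handed along the cycle as a marker, and the factor x_11 is reused at every
  step. Without such a marker, x_11 times a monomial of the cycle admits only exchanges that use up
  its one factor x_11.

  The decomposition has a mismatch to overcome: the intersection is computed from W = {} and from
  the W containing (1, 1), whereas the minimal primes are sought among the P_W of all admissible W.
  A prime containing a finite intersection of ideals contains one of them, and W is recovered from
  P_W as the set of variables lying in it; so every minimal prime of I(C) is P_W for exactly one
  W.\<close>

lemma mpoly_ring_simps [simp]:
  "mult (mpoly_ring V) = (*)" "one (mpoly_ring V) = 1"
  "zero (mpoly_ring V) = 0" "add (mpoly_ring V) = (+)"
  by (simp_all add: mpoly_ring_def)

lemma nat_pow_mpoly_ring [simp]: "p [^]\<^bsub>mpoly_ring V\<^esub> (n::nat) = p ^ n"
  by (induction n) (simp_all add: nat_pow_def mult.commute)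

lemma carrier_mpoly_ring_iff:
  "p \<in> carrier (mpoly_ring V) \<longleftrightarrow> (\<forall>t\<in>Poly_Mapping.keys p. Poly_Mapping.keys t \<subseteq> V)"
  by (simp add: mpoly_ring_def)

lemma keys_add_nat:
  fixes s t :: "'a \<Rightarrow>\<^sub>0 nat"
  shows "Poly_Mapping.keys (s + t) = Poly_Mapping.keys s \<union> Poly_Mapping.keys t"
  by (auto simp: in_keys_iff lookup_add)

lemma mpoly_closed:
  fixes p q :: "('x, 'k::field) mpoly"
  shows "0 \<in> carrier (mpoly_ring V :: ('x, 'k) mpoly ring)"
    and "1 \<in> carrier (mpoly_ring V :: ('x, 'k) mpoly ring)"
    and "p \<in> carrier (mpoly_ring V) \<Longrightarrow> q \<in> carrier (mpoly_ring V) \<Longrightarrow> p + q \<in> carrier (mpoly_ring V)"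
    and "p \<in> carrier (mpoly_ring V) \<Longrightarrow> q \<in> carrier (mpoly_ring V) \<Longrightarrow> p * q \<in> carrier (mpoly_ring V)"
    and "p \<in> carrier (mpoly_ring V) \<Longrightarrow> - p \<in> carrier (mpoly_ring V)"
    and "p \<in> carrier (mpoly_ring V) \<Longrightarrow> q \<in> carrier (mpoly_ring V) \<Longrightarrow> p - q \<in> carrier (mpoly_ring V)"
    and "x \<in> V \<Longrightarrow> Var x \<in> carrier (mpoly_ring V :: ('x, 'k) mpoly ring)"
    and "Poly_Mapping.keys t \<subseteq> V \<Longrightarrow> Poly_Mapping.single t c \<in> carrier (mpoly_ring V :: ('x, 'k) mpoly ring)"
proof -
  interpret cring "mpoly_ring V :: ('x, 'k) mpoly ring" by (rule cring_mpoly_ring)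
  show "0 \<in> carrier (mpoly_ring V :: ('x, 'k) mpoly ring)"
    "1 \<in> carrier (mpoly_ring V :: ('x, 'k) mpoly ring)"
    using zero_closed one_closed by simp_all
  show "p \<in> carrier (mpoly_ring V) \<Longrightarrow> q \<in> carrier (mpoly_ring V) \<Longrightarrow> p + q \<in> carrier (mpoly_ring V)"
    using a_closed[of p q] by simp
  show "p \<in> carrier (mpoly_ring V) \<Longrightarrow> q \<in> carrier (mpoly_ring V) \<Longrightarrow> p * q \<in> carrier (mpoly_ring V)"
    using m_closed[of p q] by simp
  show neg: "p \<in> carrier (mpoly_ring V) \<Longrightarrow> - p \<in> carrier (mpoly_ring V)" for p :: "('x, 'k) mpoly"
    by (simp add: mpoly_ring_def)
  show "p \<in> carrier (mpoly_ring V) \<Longrightarrow> q \<in> carrier (mpoly_ring V) \<Longrightarrow> p - q \<in> carrier (mpoly_ring V)"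
    using a_closed[of p "- q"] neg[of q] by simp
  show "x \<in> V \<Longrightarrow> Var x \<in> carrier (mpoly_ring V :: ('x, 'k) mpoly ring)"
    by (simp add: mpoly_ring_def Var_def)
  show "Poly_Mapping.keys t \<subseteq> V \<Longrightarrow> Poly_Mapping.single t c \<in> carrier (mpoly_ring V :: ('x, 'k) mpoly ring)"
    by (simp add: mpoly_ring_def)
qed

lemma mpoly_prod_closed:
  fixes f :: "'i \<Rightarrow> ('x, 'k::field) mpoly"
  assumes "\<And>i. i \<in> A \<Longrightarrow> f i \<in> carrier (mpoly_ring V)"
  shows "prod f A \<in> carrier (mpoly_ring V)"
  using assms by (induction A rule: infinite_finite_induct) (auto intro: mpoly_closed)

lemma ideal_mpoly_ringI:
  fixes I :: "('x, 'k::field) mpoly set"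
  assumes sub: "I \<subseteq> carrier (mpoly_ring V)" and zero: "0 \<in> I"
    and add: "\<And>p q. p \<in> I \<Longrightarrow> q \<in> I \<Longrightarrow> p + q \<in> I"
    and mult: "\<And>r p. r \<in> carrier (mpoly_ring V) \<Longrightarrow> p \<in> I \<Longrightarrow> r * p \<in> I"
  shows "ideal I (mpoly_ring V)"
proof -
  interpret cring "mpoly_ring V :: ('x, 'k) mpoly ring" by (rule cring_mpoly_ring)
  have neg: "- p \<in> I" if "p \<in> I" for p
    using mult[of "- 1" p] that mpoly_closed(2,5) by auto
  have inv: "\<ominus>\<^bsub>mpoly_ring V\<^esub> p = - p" if "p \<in> I" for p
    using that sub neg[OF that] by (intro minus_equality) auto
  show ?thesis
  proof (rule idealI)
    show "subgroup I (add_monoid (mpoly_ring V))"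
      using assms neg inv by (intro add.subgroupI) (auto simp: a_inv_def)
    show "x \<otimes>\<^bsub>mpoly_ring V\<^esub> p \<in> I" "p \<otimes>\<^bsub>mpoly_ring V\<^esub> x \<in> I"
      if "p \<in> I" "x \<in> carrier (mpoly_ring V)" for p x
      using mult[OF that(2,1)] by (simp_all add: mult.commute)
  qed (rule ring_axioms)
qed

lemma ideal_mpoly_ringD:
  fixes I :: "('x, 'k::field) mpoly set"
  assumes "ideal I (mpoly_ring V)"
  shows "I \<subseteq> carrier (mpoly_ring V)" and "0 \<in> I"
    and "p \<in> I \<Longrightarrow> q \<in> I \<Longrightarrow> p + q \<in> I"
    and "r \<in> carrier (mpoly_ring V) \<Longrightarrow> p \<in> I \<Longrightarrow> r * p \<in> I"
    and "p \<in> I \<Longrightarrow> - p \<in> I"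
    and "p \<in> I \<Longrightarrow> q \<in> I \<Longrightarrow> p - q \<in> I"
proof -
  interpret ideal I "mpoly_ring V" by fact
  show "I \<subseteq> carrier (mpoly_ring V)" "0 \<in> I"
    using a_subset additive_subgroup.zero_closed[OF is_additive_subgroup] by simp_all
  show add: "p \<in> I \<Longrightarrow> q \<in> I \<Longrightarrow> p + q \<in> I" for p q using additive_subgroup.a_closed[OF is_additive_subgroup, of p q] by simp
  show mult: "r \<in> carrier (mpoly_ring V) \<Longrightarrow> p \<in> I \<Longrightarrow> r * p \<in> I" for r p
    using I_l_closed[of p r] by simp
  show neg: "p \<in> I \<Longrightarrow> - p \<in> I" for p
    using mult[of "- 1" p] mpoly_closed(2,5)[where 'x = 'x and 'k = 'k] by simp
  show "p \<in> I \<Longrightarrow> q \<in> I \<Longrightarrow> p - q \<in> I" using add[of p "- q"] neg[of q] by simp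
qed

lemma ideal_sum_closed:
  fixes I :: "('x, 'k::field) mpoly set"
  assumes "ideal I (mpoly_ring V)" and "\<And>i. i \<in> A \<Longrightarrow> f i \<in> I"
  shows "sum f A \<in> I"
  using assms(2) ideal_mpoly_ringD[OF assms(1)]
  by (induction A rule: infinite_finite_induct) auto

lemma ideal_prod_cong:
  fixes f g :: "'i \<Rightarrow> ('x, 'k::field) mpoly"
  assumes X: "ideal X (mpoly_ring V)" and "\<And>i. i \<in> A \<Longrightarrow> f i \<in> carrier (mpoly_ring V)"
    and "\<And>i. i \<in> A \<Longrightarrow> g i \<in> carrier (mpoly_ring V)" and "\<And>i. i \<in> A \<Longrightarrow> f i - g i \<in> X"
  shows "prod f A - prod g A \<in> X"
  using assms(2-4)
proof (induction A rule: infinite_finite_induct)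
  case (insert i A)
  note D = ideal_mpoly_ringD[OF X]
  have "f i * (prod f A - prod g A) + prod g A * (f i - g i) \<in> X"
    using insert by (intro D(3,4) mpoly_prod_closed) auto
  then show ?case using insert.hyps by (simp add: algebra_simps)
qed (simp_all add: ideal_mpoly_ringD[OF X])

text \<open>Modulo \<open>X\<close>, step k trades \<open>s k * q k\<close> for
  \<open>p k * s (Suc k)\<close>: the marker \<open>s\<close> moves on by one place and one factor
  \<open>q\<close> becomes a factor \<open>p\<close>. The factor \<open>z\<close> licenses each
  trade without being used up, so one \<open>z\<close> serves a chain of any length.\<close>

lemma ideal_telescope:
  fixes z :: "('x, 'k::field) mpoly"
  assumes X: "ideal X (mpoly_ring V)"
    and p: "\<And>k. p k \<in> carrier (mpoly_ring V)" and q: "\<And>k. q k \<in> carrier (mpoly_ring V)"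
    and step: "\<And>k. z * (s k * q k - p k * s (Suc k)) \<in> X"
  shows "z * (s 0 * (\<Prod>k<j. q k) - (\<Prod>k<j. p k) * s j) \<in> X"
proof (induction j)
  case (Suc j)
  note D = ideal_mpoly_ringD[OF X]
  have "q j * (z * (s 0 * (\<Prod>k<j. q k) - (\<Prod>k<j. p k) * s j))
      + (\<Prod>k<j. p k) * (z * (s j * q j - p j * s (Suc j))) \<in> X"
    by (intro D(3) D(4)[OF q Suc.IH] D(4)[OF mpoly_prod_closed[OF p] step])
  then show ?case by (simp add: algebra_simps)
qed (simp add: ideal_mpoly_ringD[OF X])

section \<open>Push-forward of finitely supported functions\<close>

lemma poly_mapping_sum_single:
  "(\<Sum>t\<in>Poly_Mapping.keys p. Poly_Mapping.single t (Poly_Mapping.lookup p t)) = p"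
  by (rule poly_mapping_eqI)
    (auto simp: lookup_sum lookup_single when_def in_keys_iff sum.delta')

text \<open>The sum over the fibres of \<open>g\<close>. For additive \<open>g\<close> it is the
  homomorphism of monoid algebras induced by \<open>g\<close>, see \<open>push_mult\<close>. It is
  applied on two levels: to polynomials, moving monomials, and to exponent vectors, moving
  variables.\<close>

definition push :: "('a \<Rightarrow> 'b) \<Rightarrow> ('a \<Rightarrow>\<^sub>0 'c::comm_monoid_add) \<Rightarrow> 'b \<Rightarrow>\<^sub>0 'c" where
  "push g p = (\<Sum>t\<in>Poly_Mapping.keys p. Poly_Mapping.single (g t) (Poly_Mapping.lookup p t))"

lemma push_superset:
  assumes "finite S" and "Poly_Mapping.keys p \<subseteq> S"
  shows "push g p = (\<Sum>t\<in>S. Poly_Mapping.single (g t) (Poly_Mapping.lookup p t))"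
  unfolding push_def using assms by (intro sum.mono_neutral_left) (auto simp: in_keys_iff)

lemma push_0 [simp]: "push g 0 = 0"
  by (simp add: push_def)

lemma push_add: "push g (p + q) = push g p + push g q"
proof -
  let ?S = "Poly_Mapping.keys p \<union> Poly_Mapping.keys q"
  have "push g (p + q) = (\<Sum>t\<in>?S. Poly_Mapping.single (g t) (Poly_Mapping.lookup (p + q) t))"
    by (rule push_superset) (auto dest: subsetD[OF Poly_Mapping.keys_add])
  also have "\<dots> = push g p + push g q"
    by (simp add: push_superset[of ?S p] push_superset[of ?S q] lookup_add single_add sum.distrib)
  finally show ?thesis .
qed

lemma push_single [simp]: "push g (Poly_Mapping.single t c) = Poly_Mapping.single (g t) c"
  by (cases "c = 0") (simp_all add: push_def)

lemma push_uminus: "push g (- p) = - push g (p :: 'a \<Rightarrow>\<^sub>0 'c::ab_group_add)"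
  using push_add[of g p "- p"] by (simp add: eq_neg_iff_add_eq_0 add.commute)

lemma push_diff: "push g (p - q) = push g p - push g (q :: 'a \<Rightarrow>\<^sub>0 'c::ab_group_add)"
  using push_add[of g p "- q"] push_uminus[of g q] by simp

lemma push_sum: "push g (sum f A) = (\<Sum>i\<in>A. push g (f i))"
  by (induction A rule: infinite_finite_induct) (simp_all add: push_add)

lemma lookup_push:
  "Poly_Mapping.lookup (push g p) y = (\<Sum>t | t \<in> Poly_Mapping.keys p \<and> g t = y. Poly_Mapping.lookup p t)"
proof -
  have "Poly_Mapping.lookup (push g p) y
      = (\<Sum>t\<in>Poly_Mapping.keys p. if g t = y then Poly_Mapping.lookup p t else 0)"
    by (auto simp: push_def lookup_sum lookup_single when_def intro!: sum.cong)
  also have "\<dots> = (\<Sum>t | t \<in> Poly_Mapping.keys p \<and> g t = y. Poly_Mapping.lookup p t)"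
    by (simp add: sum.If_cases Int_def)
  finally show ?thesis .
qed

lemma push_mult:
  fixes p q :: "'a::comm_monoid_add \<Rightarrow>\<^sub>0 'c::comm_semiring_0"
  assumes "\<And>s t. g (s + t) = g s + g t"
  shows "push g (p * q) = push g p * push g q"
proof -
  have "push g (p * q) = push g ((\<Sum>s\<in>Poly_Mapping.keys p. Poly_Mapping.single s (Poly_Mapping.lookup p s))
      * (\<Sum>t\<in>Poly_Mapping.keys q. Poly_Mapping.single t (Poly_Mapping.lookup q t)))"
    by (simp only: poly_mapping_sum_single)
  also have "\<dots> = push g p * push g q"
    by (simp only: sum_product push_sum mult_single push_single assms push_def[of g p] push_def[of g q])
  finally show ?thesis .
qed

definition total_degree :: "('x \<Rightarrow>\<^sub>0 nat) \<Rightarrow> nat" where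
  "total_degree t = (\<Sum>x\<in>Poly_Mapping.keys t. Poly_Mapping.lookup t x)"

lemma total_degree_add: "total_degree (s + t) = total_degree s + total_degree t"
proof -
  \<comment> \<open>Pushing to the one-point type adds up all exponents, so additivity is inherited
    from \<open>push\<close>.\<close>
  have "total_degree u = Poly_Mapping.lookup (push (\<lambda>_. ()) u) ()" for u :: "'x \<Rightarrow>\<^sub>0 nat"
    by (simp add: total_degree_def lookup_push)
  from this[of "s + t"] this[of s] this[of t] show ?thesis by (simp add: push_add lookup_add)
qed

lemma total_degree_0 [simp]: "total_degree 0 = 0"
  by (simp add: total_degree_def)

lemma total_degree_single [simp]: "total_degree (Poly_Mapping.single x n) = n"
  by (cases "n = 0") (simp_all add: total_degree_def)

lemma total_degree_sum: "total_degree (sum f A) = (\<Sum>i\<in>A. total_degree (f i))"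
  by (induction A rule: infinite_finite_induct) (simp_all add: total_degree_add)

lemma prod_single:
  "(\<Prod>i\<in>A. Poly_Mapping.single (f i) 1) = Poly_Mapping.single (sum f A) (1 :: 'c::comm_semiring_1)"
  by (induction A rule: infinite_finite_induct) (simp_all add: mult_single)

lemma prod_Var:
  "(\<Prod>i\<in>A. Var (f i)) =
    (Poly_Mapping.single (\<Sum>i\<in>A. Poly_Mapping.single (f i) 1) 1 :: ('x, 'k::field) mpoly)"
  unfolding Var_def by (rule prod_single)

lemma monomial_split:
  fixes t :: "'x \<Rightarrow>\<^sub>0 nat"
  assumes "finite A" "A \<subseteq> Poly_Mapping.keys t"
  obtains s where "t = (\<Sum>x\<in>A. Poly_Mapping.single x 1) + s"
proof -
  let ?u = "\<Sum>x\<in>A. Poly_Mapping.single x (1::nat)"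
  have "Poly_Mapping.lookup ?u y = (if y \<in> A then 1 else 0)" for y
    using assms(1) by (simp add: lookup_sum lookup_single when_def sum.delta')
  moreover have "Poly_Mapping.lookup t y \<ge> 1" if "y \<in> A" for y
    using that assms(2) by (auto simp: in_keys_iff Suc_le_eq)
  ultimately have "t = ?u + (t - ?u)"
    by (intro poly_mapping_eqI) (auto simp: lookup_add lookup_minus)
  then show ?thesis by (rule that)
qed

lemma monomial_split1:
  fixes t :: "'x \<Rightarrow>\<^sub>0 nat"
  assumes "x \<in> Poly_Mapping.keys t"
  obtains s where "t = Poly_Mapping.single x 1 + s"
  using monomial_split[of "{x}" t] assms by auto

section \<open>Prime ideals of monomial type\<close>

text \<open>The target is a monoid algebra over a field with linearly ordered, cancellative
  exponents. Such an algebra is a domain, so the kernel of a homomorphism into it is prime.\<close>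

lemma kernel_push_primeideal:
  fixes V :: "'x set" and g :: "('x \<Rightarrow>\<^sub>0 nat) \<Rightarrow> 'b::{ordered_cancel_comm_monoid_add, linorder}"
  assumes "\<And>s t. g (s + t) = g s + g t"
  shows "primeideal {p \<in> carrier (mpoly_ring V :: ('x, 'k::field) mpoly ring). push g p = 0} (mpoly_ring V)"
proof (rule primeidealI)
  let ?J = "{p \<in> carrier (mpoly_ring V :: ('x, 'k) mpoly ring). push g p = 0}"
  show "ideal ?J (mpoly_ring V)"
    by (rule ideal_mpoly_ringI) (auto simp: mpoly_closed push_add push_mult assms)
  have "1 \<notin> ?J"
    using push_single[of g 0 "1::'k"] by (simp add: single_one[symmetric] del: push_single single_one)
      (metis single_zero inj_single injD one_neq_zero)
  then show "carrier (mpoly_ring V) \<noteq> ?J" using mpoly_closed(2) by blast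
  fix p q :: "('x, 'k) mpoly"
  assume "p \<in> carrier (mpoly_ring V)" "q \<in> carrier (mpoly_ring V)" "p \<otimes>\<^bsub>mpoly_ring V\<^esub> q \<in> ?J"
  then show "p \<in> ?J \<or> q \<in> ?J" by (simp add: push_mult assms)
qed (rule cring_mpoly_ring)

text \<open>The ideal generated by the variables of \<open>W\<close> (\<open>Idl_Var\<close>),
  described so that membership can be tested one monomial at a time.\<close>

definition var_ideal :: "'x set \<Rightarrow> 'x set \<Rightarrow> ('x, 'k::field) mpoly set" where
  "var_ideal V W = {p \<in> carrier (mpoly_ring V). \<forall>t\<in>Poly_Mapping.keys p. Poly_Mapping.keys t \<inter> W \<noteq> {}}"

lemma ideal_var_ideal: "ideal (var_ideal V W :: ('x, 'k::field) mpoly set) (mpoly_ring V)"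
proof (rule ideal_mpoly_ringI)
  fix p q :: "('x, 'k) mpoly" assume "p \<in> var_ideal V W" "q \<in> var_ideal V W"
  then show "p + q \<in> var_ideal V W"
    using Poly_Mapping.keys_add[of p q] by (fastforce simp: var_ideal_def mpoly_closed)
next
  fix r p :: "('x, 'k) mpoly" assume "r \<in> carrier (mpoly_ring V)" "p \<in> var_ideal V W"
  then show "r * p \<in> var_ideal V W"
    using keys_mult[of r p] by (fastforce simp: var_ideal_def mpoly_closed keys_add_nat)
qed (auto simp: var_ideal_def mpoly_closed)

lemma Idl_Var:
  assumes "W \<subseteq> V"
  shows "Idl\<^bsub>mpoly_ring V\<^esub> (Var ` W) = (var_ideal V W :: ('x, 'k::field) mpoly set)"
proof
  interpret cring "mpoly_ring V :: ('x, 'k) mpoly ring" by (rule cring_mpoly_ring)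
  have W: "Var ` W \<subseteq> carrier (mpoly_ring V :: ('x, 'k) mpoly ring)"
    using assms by (auto intro: mpoly_closed(7))
  show "Idl\<^bsub>mpoly_ring V\<^esub> (Var ` W) \<subseteq> (var_ideal V W :: ('x, 'k) mpoly set)"
    using W by (intro genideal_minimal ideal_var_ideal) (auto simp: var_ideal_def Var_def)
  have I: "ideal (Idl\<^bsub>mpoly_ring V\<^esub> (Var ` W)) (mpoly_ring V :: ('x, 'k) mpoly ring)"
    by (rule genideal_ideal[OF W])
  show "(var_ideal V W :: ('x, 'k) mpoly set) \<subseteq> Idl\<^bsub>mpoly_ring V\<^esub> (Var ` W)"
  proof
    fix p :: "('x, 'k) mpoly" assume p: "p \<in> var_ideal V W"
    have "Poly_Mapping.single t (Poly_Mapping.lookup p t) \<in> Idl\<^bsub>mpoly_ring V\<^esub> (Var ` W)"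
      if t: "t \<in> Poly_Mapping.keys p" for t
    proof -
      obtain x where x: "x \<in> W" "x \<in> Poly_Mapping.keys t" using p t by (auto simp: var_ideal_def)
      then obtain s where s: "t = Poly_Mapping.single x 1 + s" by (elim monomial_split1)
      have "Poly_Mapping.keys t \<subseteq> V" using p t by (auto simp: var_ideal_def carrier_mpoly_ring_iff)
      then have "Poly_Mapping.single s (Poly_Mapping.lookup p t) \<in> carrier (mpoly_ring V)"
        by (intro mpoly_closed) (auto simp: s keys_add_nat)
      from ideal_mpoly_ringD(4)[OF I this] genideal_self[OF W] x(1)
      have "Poly_Mapping.single s (Poly_Mapping.lookup p t) * Var x \<in> Idl\<^bsub>mpoly_ring V\<^esub> (Var ` W)"
        by blast
      then show ?thesis by (simp add: Var_def mult_single s add.commute)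
    qed
    then have "(\<Sum>t\<in>Poly_Mapping.keys p. Poly_Mapping.single t (Poly_Mapping.lookup p t))
        \<in> Idl\<^bsub>mpoly_ring V\<^esub> (Var ` W)"
      by (rule ideal_sum_closed[OF I])
    then show "p \<in> Idl\<^bsub>mpoly_ring V\<^esub> (Var ` W)" by (simp only: poly_mapping_sum_single)
  qed
qed

text \<open>Modulo the ideal, each polynomial is represented by its part whose monomials avoid
  \<open>W\<close>. Products of such parts again avoid \<open>W\<close>, so a product that lies in
  the ideal is 0 there, and the polynomial ring is a domain; this is where the linear order on the
  variables enters.\<close>

lemma primeideal_var_ideal:
  "primeideal (var_ideal V W :: ('x::linorder, 'k::field) mpoly set) (mpoly_ring V)"
proof (rule primeidealI[OF ideal_var_ideal cring_mpoly_ring])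
  have "1 \<notin> (var_ideal V W :: ('x, 'k) mpoly set)" by (simp add: var_ideal_def)
  then show "carrier (mpoly_ring V) \<noteq> (var_ideal V W :: ('x, 'k) mpoly set)"
    using mpoly_closed(2) by blast
  have split: "\<exists>q r. p = q + r \<and> r \<in> var_ideal V W \<and> q \<in> carrier (mpoly_ring V) \<and>
      (\<forall>t\<in>Poly_Mapping.keys q. Poly_Mapping.keys t \<inter> W = {})"
    if p: "p \<in> carrier (mpoly_ring V)" for p :: "('x, 'k) mpoly"
  proof -
    let ?K = "{t. Poly_Mapping.keys t \<inter> W = {}}" and ?k = "Poly_Mapping.keys p"
    let ?m = "\<lambda>t. Poly_Mapping.single t (Poly_Mapping.lookup p t)"
    have 1: "p = sum ?m (?k \<inter> ?K) + sum ?m (?k - ?K)"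
      using poly_mapping_sum_single[of p] by (simp add: sum.Int_Diff[of ?k _ ?K])
    have 2: "Poly_Mapping.keys (sum ?m A) \<subseteq> A" for A
      using keys_sum[of ?m A] by (auto split: if_splits)
    show ?thesis
      using p 2[of "?k \<inter> ?K"] 2[of "?k - ?K"]
      by (intro exI[of _ "sum ?m (?k \<inter> ?K)"] exI[of _ "sum ?m (?k - ?K)"] conjI 1)
        (auto simp: var_ideal_def carrier_mpoly_ring_iff)
  qed
  fix p q :: "('x, 'k) mpoly"
  assume p: "p \<in> carrier (mpoly_ring V)" and q: "q \<in> carrier (mpoly_ring V)"
    and pq: "p \<otimes>\<^bsub>mpoly_ring V\<^esub> q \<in> var_ideal V W"
  obtain p0 p1 where p01: "p = p0 + p1" "p1 \<in> var_ideal V W" "p0 \<in> carrier (mpoly_ring V)"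
    "\<forall>t\<in>Poly_Mapping.keys p0. Poly_Mapping.keys t \<inter> W = {}" using split[OF p] by blast
  obtain q0 q1 where q01: "q = q0 + q1" "q1 \<in> var_ideal V W" "q0 \<in> carrier (mpoly_ring V)"
    "\<forall>t\<in>Poly_Mapping.keys q0. Poly_Mapping.keys t \<inter> W = {}" using split[OF q] by blast
  note D = ideal_mpoly_ringD[OF ideal_var_ideal[of V W, where 'k = 'k]]
  have "p0 * q0 = p * q - (p0 * q1 + q * p1)" by (simp add: p01(1) q01(1) algebra_simps)
  also have "\<dots> \<in> var_ideal V W"
    using pq D(4)[OF p01(3) q01(2)] D(4)[OF q p01(2)] by (intro D(6) D(3)) auto
  finally have "p0 * q0 \<in> var_ideal V W" .
  moreover have "Poly_Mapping.keys t \<inter> W = {}" if "t \<in> Poly_Mapping.keys (p0 * q0)" for t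
    using that keys_mult[of p0 q0] p01(4) q01(4) by (fastforce simp: keys_add_nat)
  ultimately have "Poly_Mapping.keys (p0 * q0) = {}" by (auto simp: var_ideal_def)
  then have "p0 * q0 = 0" by simp
  then have "p0 = 0 \<or> q0 = 0" by simp
  then show "p \<in> var_ideal V W \<or> q \<in> var_ideal V W" using p01 q01 by auto
qed

section \<open>Intersections of primes\<close>

context cring
begin

text \<open>If \<open>x\<close> lies in \<open>P i\<close> but not in \<open>Q\<close>,
  multiplication by \<open>x\<close> carries the intersection of the remaining ideals into the full
  one, and primality cancels \<open>x\<close> again. For empty \<open>A\<close> the intersection is
  the whole ring, which a prime ideal cannot contain.\<close>

lemma prime_contains_Inter:
  assumes "primeideal Q R" and "finite A" and "\<And>i. i \<in> A \<Longrightarrow> ideal (P i) R"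
    and "carrier R \<inter> (\<Inter>i\<in>A. P i) \<subseteq> Q"
  shows "\<exists>i\<in>A. P i \<subseteq> Q"
proof -
  interpret Q: primeideal Q R by fact
  show ?thesis
    using assms(2-4)
  proof (induction A rule: finite_induct)
    case empty
    then show ?case using Q.I_notcarr Q.a_subset by auto
  next
    case (insert i A)
    show ?case
    proof (cases "P i \<subseteq> Q")
      case False
      then obtain x where x: "x \<in> P i" "x \<notin> Q" by blast
      interpret Pi: ideal "P i" R by (simp add: insert.prems)
      have xc: "x \<in> carrier R" using x Pi.a_subset by auto
      have "y \<in> Q" if y: "y \<in> carrier R \<inter> (\<Inter>i\<in>A. P i)" for y
      proof -
        have "x \<otimes> y \<in> P i" using x y Pi.I_r_closed by simp
        moreover have "x \<otimes> y \<in> P j" if "j \<in> A" for j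
          using ideal.I_l_closed[of "P j" R y x] that y xc insert.prems(1) by auto
        ultimately have "x \<otimes> y \<in> Q" using insert.prems(2) xc y by auto
        then show ?thesis using Q.I_prime x xc y by blast
      qed
      then have "\<exists>j\<in>A. P j \<subseteq> Q" using insert.prems by (intro insert.IH) auto
      then show ?thesis by blast
    qed auto
  qed
qed

lemma prime_nat_powD:
  assumes "primeideal P R" "x \<in> carrier R" "x [^] (n::nat) \<in> P"
  shows "x \<in> P"
proof -
  interpret P: primeideal P R by fact
  show ?thesis
    using assms(3)
  proof (induction n)
    case 0
    then show ?case using P.I_notcarr P.one_imp_carrier by auto
  next
    case (Suc n)
    then show ?case using P.I_prime assms(2) by auto
  qed
qed

lemma radical_of_prime:
  assumes "primeideal P R"
  shows "radical_of R P = P"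
proof -
  interpret P: primeideal P R by fact
  have "x [^] (1::nat) \<in> P" if "x \<in> P" for x using that P.a_subset by auto
  then show ?thesis
    using prime_nat_powD[OF assms] P.a_subset unfolding radical_of_def by blast
qed

lemma primary_ideal_prime:
  assumes "primeideal P R"
  shows "primary_ideal R P"
proof -
  interpret P: primeideal P R by fact
  show ?thesis
    unfolding primary_ideal_def radical_of_prime[OF assms]
    using P.is_ideal P.I_notcarr P.I_prime by auto
qed

lemma radical_ideal_Inter_primes:
  assumes P: "\<And>i. i \<in> A \<Longrightarrow> primeideal (P i) R" and I: "carrier R \<inter> (\<Inter>i\<in>A. P i) = I"
  shows "radical_ideal R I"
proof -
  have "ideal (\<Inter> (insert (carrier R) (P ` A))) R"
    using P primeideal.axioms(1) oneideal by (intro i_Intersect) auto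
  then have ideal: "ideal I R" using I by simp
  have "radical_of R I = I"
  proof
    show "radical_of R I \<subseteq> I"
    proof
      fix x assume "x \<in> radical_of R I"
      then obtain n :: nat where x: "x \<in> carrier R" "x [^] n \<in> I" by (auto simp: radical_of_def)
      then have "x \<in> P i" if "i \<in> A" for i
        using that I by (intro prime_nat_powD[OF P[OF that] x(1), of n]) auto
      then show "x \<in> I" using x(1) I by auto
    qed
    have "x [^] (1::nat) \<in> I" if "x \<in> I" for x using that I by auto
    then show "I \<subseteq> radical_of R I" using I unfolding radical_of_def by blast
  qed
  then show ?thesis using ideal by (simp add: radical_ideal_def)
qed

text \<open>Two index sets are involved: \<open>A\<close> computes the intersection, and the larger
  \<open>N\<close> is where the minimal primes are looked up. Injectivity on \<open>N\<close> yields
  distinct radicals. It also yields irredundancy: a component containing the intersection of the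
  others contains one of them, hence equals it by minimality.\<close>

lemma primary_decomposition_minimal_primes:
  assumes A: "finite A" and P: "\<And>i. i \<in> A \<Longrightarrow> primeideal (P i) R"
    and I: "carrier R \<inter> (\<Inter>i\<in>A. P i) = I"
    and AN: "A \<subseteq> N" and N: "finite N" and inj: "inj_on P N"
  shows "primary_decomposition R I {i \<in> N. minimal_prime R I (P i)} P"
proof -
  let ?B = "{i \<in> N. minimal_prime R I (P i)}"
  have prime: "primeideal (P i) R" "I \<subseteq> P i" if "i \<in> ?B" for i
    using that by (auto simp: minimal_prime_def)
  have below: "\<exists>i\<in>A. P i \<subseteq> Q" if "primeideal Q R" "I \<subseteq> Q" for Q
    using prime_contains_Inter[OF that(1) A, of P] P I that(2) primeideal.axioms(1) by blast
  have min: "\<exists>j\<in>?B. P j \<subseteq> P i" if i: "i \<in> A" for i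
  proof -
    \<comment> \<open>An inclusion-minimal member of the finite family below \<open>P i\<close> is a
      minimal prime of \<open>I\<close>, because every prime over \<open>I\<close> contains some
      member of the family.\<close>
    have "finite {X \<in> P ` A. X \<subseteq> P i}" "P i \<in> {X \<in> P ` A. X \<subseteq> P i}" using A i by auto
    from finite_has_minimal2[OF this] obtain j where
      j: "j \<in> A" "P j \<subseteq> P i" "\<And>k. k \<in> A \<Longrightarrow> P k \<subseteq> P i \<Longrightarrow> P k \<subseteq> P j \<Longrightarrow> P k = P j"
      by (smt (verit) image_iff mem_Collect_eq)
    have "Q = P j" if "primeideal Q R" "I \<subseteq> Q" "Q \<subseteq> P j" for Q
      using below[OF that(1,2)] j that(3) by blast
    then have "minimal_prime R I (P j)"
      using P[OF j(1)] I j(1) unfolding minimal_prime_def by auto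
    then show ?thesis using j AN by auto
  qed
  have "carrier R \<inter> (\<Inter>i\<in>?B. P i) \<subseteq> I"
    using min I by blast
  then have Inter: "carrier R \<inter> (\<Inter>i\<in>?B. P i) = I"
    using prime(2) I by blast
  have irr: "carrier R \<inter> (\<Inter>j\<in>?B - {i}. P j) \<noteq> I" if i: "i \<in> ?B" for i
  proof
    assume "carrier R \<inter> (\<Inter>j\<in>?B - {i}. P j) = I"
    then have "\<exists>j\<in>?B - {i}. P j \<subseteq> P i"
      using prime N i by (intro prime_contains_Inter) (auto simp: primeideal.axioms(1))
    then obtain j where j: "j \<in> ?B" "j \<noteq> i" "P j \<subseteq> P i" by blast
    have "\<forall>Q. primeideal Q R \<and> I \<subseteq> Q \<and> Q \<subseteq> P i \<longrightarrow> Q = P i"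
      using i by (simp add: minimal_prime_def)
    then have "P j = P i" using prime[OF j(1)] j(3) by blast
    then show False using inj_onD[OF inj, of j i] j(1,2) i by blast
  qed
  have "inj_on (\<lambda>i. radical_of R (P i)) ?B"
    using inj prime(1) by (simp add: inj_on_def radical_of_prime)
  then show ?thesis
    unfolding primary_decomposition_def
    using N prime(1) Inter irr primary_ideal_prime by auto
qed

end

section \<open>The toric ideal of an edge set\<close>

text \<open>If the image of \<open>p\<close> vanishes, no monomial \<open>u\<close> of
  \<open>p\<close> can be alone in its fibre, since its coefficient would survive. With a second
  monomial \<open>v\<close> in the fibre, subtracting the multiple of the binomial u - v that
  cancels \<open>u\<close> introduces no new monomial, so the number of monomials drops.\<close>

lemma kernel_push_subset:
  fixes g :: "('x \<Rightarrow>\<^sub>0 nat) \<Rightarrow> 'b" and X :: "('x, 'k::field) mpoly set"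
  assumes X: "ideal X (mpoly_ring V)"
    and bin: "\<And>u v. Poly_Mapping.keys u \<subseteq> V \<Longrightarrow> Poly_Mapping.keys v \<subseteq> V \<Longrightarrow> g u = g v \<Longrightarrow>
      Poly_Mapping.single u 1 - Poly_Mapping.single v 1 \<in> X"
  shows "p \<in> carrier (mpoly_ring V) \<Longrightarrow> push g p = 0 \<Longrightarrow> p \<in> X"
proof (induction "card (Poly_Mapping.keys p)" arbitrary: p rule: less_induct)
  case less
  note D = ideal_mpoly_ringD[OF X]
  show ?case
  proof (cases "p = 0")
    case False
    then have "Poly_Mapping.keys p \<noteq> {}" by simp
    then obtain u where u: "u \<in> Poly_Mapping.keys p" by blast
    let ?c = "Poly_Mapping.lookup p u"
    have "\<exists>v. v \<in> Poly_Mapping.keys p \<and> g v = g u \<and> v \<noteq> u"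
    proof (rule ccontr)
      assume "\<not> ?thesis"
      then have "{t. t \<in> Poly_Mapping.keys p \<and> g t = g u} = {u}" using u by blast
      then have "Poly_Mapping.lookup (push g p) (g u) = ?c" by (simp add: lookup_push)
      then show False using less.prems(2) u by (simp add: in_keys_iff)
    qed
    then obtain v where v: "v \<in> Poly_Mapping.keys p" "g v = g u" "v \<noteq> u" by blast
    have uv: "Poly_Mapping.keys u \<subseteq> V" "Poly_Mapping.keys v \<subseteq> V"
      using u v less.prems(1) by (auto simp: carrier_mpoly_ring_iff)
    define q where "q = p - (Poly_Mapping.single u ?c - Poly_Mapping.single v ?c)"
    have "Poly_Mapping.single 0 ?c * (Poly_Mapping.single u 1 - Poly_Mapping.single v 1) \<in> X"
      using uv v(2) by (intro D(4) bin mpoly_closed) auto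
    then have mem: "Poly_Mapping.single u ?c - Poly_Mapping.single v ?c \<in> X"
      by (simp add: algebra_simps mult_single)
    have "Poly_Mapping.keys q \<subseteq> Poly_Mapping.keys p - {u}"
      using u v by (auto simp: q_def in_keys_iff lookup_minus lookup_single when_def split: if_splits)
    then have "card (Poly_Mapping.keys q) < card (Poly_Mapping.keys p)"
      using u by (intro psubset_card_mono) auto
    moreover have "q \<in> carrier (mpoly_ring V)"
      unfolding q_def using less.prems(1) uv by (intro mpoly_closed)
    moreover have "push g q = 0" using less.prems(2) v(2) by (simp add: q_def push_diff)
    ultimately have "q \<in> X" by (rule less.hyps)
    from D(3)[OF this mem] show ?thesis by (simp add: q_def)
  qed (simp add: D(2))
qed

text \<open>The exponent vector of the image monomial when x_ab becomes a row variable times a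
  column variable: \<open>(False, a)\<close> stands for row \<open>a\<close> and
  \<open>(True, b)\<close> for column \<open>b\<close>.\<close>

definition bidegree :: "(vertex \<Rightarrow>\<^sub>0 nat) \<Rightarrow> (bool \<times> nat) \<Rightarrow>\<^sub>0 nat" where
  "bidegree t = push (\<lambda>x. (False, fst x)) t + push (\<lambda>x. (True, snd x)) t"

lemma bidegree_add: "bidegree (s + t) = bidegree s + bidegree t"
  by (simp add: bidegree_def push_add algebra_simps)

lemma bidegree_0 [simp]: "bidegree 0 = 0"
  by (simp add: bidegree_def)

lemma bidegree_single:
  "bidegree (Poly_Mapping.single x n) = Poly_Mapping.single (False, fst x) n + Poly_Mapping.single (True, snd x) n"
  by (simp add: bidegree_def)

lemma bidegree_sum: "bidegree (sum f A) = (\<Sum>i\<in>A. bidegree (f i))"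
  by (induction A rule: infinite_finite_induct) (simp_all add: bidegree_add)

lemma bidegree_keys:
  "(False, a) \<in> Poly_Mapping.keys (bidegree t) \<longleftrightarrow> (\<exists>b. (a, b) \<in> Poly_Mapping.keys t)"
  "(True, b) \<in> Poly_Mapping.keys (bidegree t) \<longleftrightarrow> (\<exists>a. (a, b) \<in> Poly_Mapping.keys t)"
  by (auto simp: bidegree_def keys_add_nat in_keys_iff lookup_push sum_eq_0_iff)

text \<open>Reading (a, b) as an edge between row a and column b, this is the toric ideal of a
  bipartite graph.\<close>

definition toric_ideal :: "vertex set \<Rightarrow> (vertex, 'k::field) mpoly set" where
  "toric_ideal V = {p \<in> carrier (mpoly_ring V). push bidegree p = 0}"

lemma primeideal_toric_ideal: "primeideal (toric_ideal V :: (vertex, 'k::field) mpoly set) (mpoly_ring V)"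
  unfolding toric_ideal_def by (rule kernel_push_primeideal) (rule bidegree_add)

text \<open>By pigeonhole the orbit of \<open>x\<close> reaches a periodic point \<open>y\<close>.
  Taking its least period \<open>r\<close> makes the iterates distinct: equality of the iterates k <
  l below \<open>r\<close> would make r - l + k a smaller period.\<close>

lemma finite_orbit_cycle:
  assumes "finite A" "x \<in> A" "\<And>y. y \<in> A \<Longrightarrow> F y \<in> A"
  obtains y r where "y \<in> A" "0 < r" "(F ^^ r) y = y" "inj_on (\<lambda>k. (F ^^ k) y) {..<r}"
proof -
  have A: "(F ^^ k) x \<in> A" for k using assms(2,3) by (induction k) auto
  have "\<not> inj_on (\<lambda>k. (F ^^ k) x) UNIV"
    using A assms(1) finite_imageD[of "\<lambda>k. (F ^^ k) x" UNIV] finite_subset[of "range (\<lambda>k. (F ^^ k) x)" A]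
    by auto
  then obtain i j :: nat where "(F ^^ i) x = (F ^^ j) x" "i \<noteq> j" by (auto simp: inj_on_def)
  then obtain i j :: nat where ij: "(F ^^ i) x = (F ^^ j) x" "i < j" by (metis linorder_neqE_nat)
  define y where "y = (F ^^ i) x"
  have ex: "\<exists>r. 0 < r \<and> (F ^^ r) y = y"
  proof (intro exI conjI)
    show "0 < j - i" using ij by simp
    have "(F ^^ (j - i)) y = (F ^^ (j - i + i)) x" by (simp only: y_def funpow_add comp_apply)
    then show "(F ^^ (j - i)) y = y" using ij by (simp add: y_def)
  qed
  define r where "r = (LEAST r. 0 < r \<and> (F ^^ r) y = y)"
  have r: "0 < r" "(F ^^ r) y = y" using LeastI_ex[OF ex] by (simp_all add: r_def)
  have least: "r \<le> s" if "0 < s" "(F ^^ s) y = y" for s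
    unfolding r_def by (rule Least_le) (use that in simp)
  have "(F ^^ k) y \<noteq> (F ^^ l) y" if "k < l" "l < r" for k l
  proof
    assume eq: "(F ^^ k) y = (F ^^ l) y"
    have "(F ^^ (r - l + k)) y = (F ^^ (r - l)) ((F ^^ l) y)" by (simp add: funpow_add eq)
    also have "\<dots> = (F ^^ (r - l + l)) y" by (simp only: funpow_add comp_apply)
    also have "\<dots> = y" using that r(2) by simp
    finally show False using least[of "r - l + k"] that by simp
  qed
  then have "inj_on (\<lambda>k. (F ^^ k) y) {..<r}"
    by (intro inj_onI) (metis lessThan_iff linorder_neqE_nat)
  with r A show ?thesis by (intro that[of y r]) (auto simp: y_def)
qed

text \<open>The sequences live on all of \<open>nat\<close> and have period \<open>r\<close>, so the
  closing edge needs no modular index and rotating the cycle is a shift of the argument. Separate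
  sets \<open>U\<close> and \<open>V\<close> allow the two kinds of edges to come from two different
  monomials.\<close>

definition alternating_cycle :: "vertex set \<Rightarrow> vertex set \<Rightarrow> nat \<Rightarrow> (nat \<Rightarrow> nat) \<Rightarrow> (nat \<Rightarrow> nat) \<Rightarrow> bool" where
  "alternating_cycle U V r a b \<longleftrightarrow> 2 \<le> r \<and> inj_on a {..<r} \<and> inj_on b {..<r} \<and>
     (\<forall>k. a (k + r) = a k) \<and> (\<forall>k. b (k + r) = b k) \<and>
     (\<forall>k. (a k, b k) \<in> U) \<and> (\<forall>k. (a (Suc k), b k) \<in> V)"

definition alternating_poly :: "nat \<Rightarrow> (nat \<Rightarrow> nat) \<Rightarrow> (nat \<Rightarrow> nat) \<Rightarrow> (vertex, 'k::field) mpoly" where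
  "alternating_poly r a b = (\<Prod>k<r. Var (a k, b k)) - (\<Prod>k<r. Var (a (Suc k), b k))"

text \<open>Leave a row through a variable of \<open>u\<close> and return from the column reached
  through a variable of \<open>v\<close>. Equal bidegrees guarantee that this column occurs in
  \<open>v\<close> and that the new row occurs in \<open>u\<close>, so the walk never stops and
  closes up in the finite set of rows. Disjointness of the supports excludes period 1, where both
  steps would use the same variable.\<close>

lemma alternating_cycle_exists:
  assumes bideg: "bidegree u = bidegree v" and disj: "Poly_Mapping.keys u \<inter> Poly_Mapping.keys v = {}"
    and "u \<noteq> 0"
  shows "\<exists>r a b. alternating_cycle (Poly_Mapping.keys u) (Poly_Mapping.keys v) r a b"
proof -
  let ?U = "Poly_Mapping.keys u" and ?V = "Poly_Mapping.keys v"
  have "?U \<noteq> {}" using assms(3) by simp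
  then obtain a0 where a0: "a0 \<in> fst ` ?U" by blast
  have "\<forall>a\<in>fst ` ?U. \<exists>b. (a, b) \<in> ?U" by auto
  then obtain f where f: "\<And>a. a \<in> fst ` ?U \<Longrightarrow> (a, f a) \<in> ?U" by metis
  have "\<forall>b\<in>snd ` ?U. \<exists>a. (a, b) \<in> ?V"
  proof
    fix b assume "b \<in> snd ` ?U"
    then have "(True, b) \<in> Poly_Mapping.keys (bidegree u)" by (auto simp: bidegree_keys)
    then show "\<exists>a. (a, b) \<in> ?V" by (simp add: bideg bidegree_keys)
  qed
  then obtain g where g: "\<And>b. b \<in> snd ` ?U \<Longrightarrow> (g b, b) \<in> ?V" by metis
  have f': "f a \<in> snd ` ?U" if "a \<in> fst ` ?U" for a using f[OF that] by force
  have gU: "g b \<in> fst ` ?U" if "b \<in> snd ` ?U" for b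
  proof -
    have "(False, g b) \<in> Poly_Mapping.keys (bidegree v)" using g[OF that] by (auto simp: bidegree_keys)
    then show ?thesis by (force simp: bideg[symmetric] bidegree_keys)
  qed
  obtain y r where y: "y \<in> fst ` ?U" and r: "0 < r" "((g \<circ> f) ^^ r) y = y"
    and inj: "inj_on (\<lambda>k. ((g \<circ> f) ^^ k) y) {..<r}"
    using finite_orbit_cycle[of "fst ` ?U" a0 "g \<circ> f"] a0 f' gU by (metis comp_apply finite_imageI finite_keys)
  define a where "a = (\<lambda>k. ((g \<circ> f) ^^ k) y)"
  define b where "b = (\<lambda>k. f (a k))"
  have a: "a k \<in> fst ` ?U" for k unfolding a_def using y f' gU by (induction k) auto
  have aS: "a (Suc k) = g (b k)" for k by (simp add: a_def b_def)
  have per: "a (k + r) = a k" for k by (simp add: a_def funpow_add r)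
  have U: "(a k, b k) \<in> ?U" for k using f[OF a] by (simp add: b_def)
  have V: "(a (Suc k), b k) \<in> ?V" for k using g[OF f'[OF a[of k]]] by (simp add: aS b_def)
  have "r \<noteq> 1"
  proof
    assume "r = 1"
    then have "a (Suc 0) = a 0" using per[of 0] by simp
    then show False using U[of 0] V[of 0] disj by auto
  qed
  moreover have "inj_on b {..<r}"
  proof (rule inj_onI)
    fix k l assume kl: "k \<in> {..<r}" "l \<in> {..<r}" "b k = b l"
    \<comment> \<open>The next row is \<open>g\<close> of the column, so equal columns have equal
      next rows. The cyclic successors of \<open>k\<close> and \<open>l\<close> are taken below
      \<open>r\<close>, where the rows are known to be distinct.\<close>
    have "\<exists>k'<r. a (Suc k) = a k' \<and> (Suc k = k' \<or> Suc k = r \<and> k' = 0)" if "k < r" for k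
      using that per[of 0] by (cases "Suc k = r") auto
    then obtain k' l' where k': "k' < r" "a (Suc k) = a k'" "Suc k = k' \<or> Suc k = r \<and> k' = 0"
      and l': "l' < r" "a (Suc l) = a l'" "Suc l = l' \<or> Suc l = r \<and> l' = 0"
      using kl by (metis lessThan_iff)
    have "a k' = a l'" using k' l' kl(3) aS by metis
    then have "k' = l'" using inj k' l' unfolding a_def by (auto dest: inj_onD)
    then show "k = l" using k' l' by auto
  qed
  ultimately have "alternating_cycle ?U ?V r a b"
    unfolding alternating_cycle_def using r(1) inj per U V by (auto simp: a_def[symmetric]) (simp add: b_def per)
  then show ?thesis by blast
qed

lemma alternating_cycle_mono:
  "alternating_cycle U V r a b \<Longrightarrow> U \<subseteq> U' \<Longrightarrow> V \<subseteq> V' \<Longrightarrow> alternating_cycle U' V' r a b"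
  unfolding alternating_cycle_def by blast

lemma prod_periodic_Suc:
  fixes g :: "nat \<Rightarrow> 'a::comm_monoid_mult"
  assumes "g r = g 0"
  shows "(\<Prod>k<r. g (Suc k)) = (\<Prod>k<r. g k)"
proof (cases r)
  case (Suc r')
  have "(\<Prod>k<r. g (Suc k)) = (\<Prod>k<r'. g (Suc k)) * g 0" using assms by (simp add: Suc)
  also have "\<dots> = (\<Prod>k<r. g k)"
    by (simp add: Suc prod.lessThan_Suc_shift mult.commute del: prod.lessThan_Suc)
  finally show ?thesis .
qed simp

lemma prod_periodic_shift:
  fixes g :: "nat \<Rightarrow> 'a::comm_monoid_mult"
  assumes "\<And>k. g (k + r) = g k"
  shows "(\<Prod>k<r. g (k + j)) = (\<Prod>k<r. g k)"
proof (induction j)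
  case (Suc j)
  have "(\<Prod>k<r. g (Suc k + j)) = (\<Prod>k<r. g (k + j))"
    using assms[of j] by (intro prod_periodic_Suc) (simp add: add.commute)
  then show ?case using Suc.IH by simp
qed simp

lemma sum_single_bidegree:
  "bidegree (\<Sum>k\<in>A. Poly_Mapping.single (f k, g k) 1)
     = (\<Sum>k\<in>A. Poly_Mapping.single (False, f k) 1) + (\<Sum>k\<in>A. Poly_Mapping.single (True, g k) 1)"
  by (simp add: bidegree_sum bidegree_single sum.distrib)

lemma sum_periodic_Suc:
  fixes g :: "nat \<Rightarrow> 'a::comm_monoid_add"
  assumes "g r = g 0"
  shows "(\<Sum>k<r. g (Suc k)) = (\<Sum>k<r. g k)"
proof (cases r)
  case (Suc r')
  have "(\<Sum>k<r. g (Suc k)) = (\<Sum>k<r'. g (Suc k)) + g 0" using assms by (simp add: Suc)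
  also have "\<dots> = (\<Sum>k<r. g k)"
    by (simp add: Suc sum.lessThan_Suc_shift add.commute del: sum.lessThan_Suc)
  finally show ?thesis .
qed simp

text \<open>Induction on the degree. A common variable is cancelled. Otherwise a cycle supplies
  divisors u0 of u and v0 of v with u0 - v0 in \<open>X\<close>, and u0 u1 - v0 v1 = u1 (u0 - v0) +
  v0 (u1 - v1) leaves a binomial of smaller degree and equal bidegrees.\<close>

lemma binomial_mem_of_cycles:
  fixes X :: "(vertex, 'k::field) mpoly set"
  assumes X: "ideal X (mpoly_ring V)"
    and cyc: "\<And>r a b. alternating_cycle V V r a b \<Longrightarrow> alternating_poly r a b \<in> X"
  shows "Poly_Mapping.keys u \<subseteq> V \<Longrightarrow> Poly_Mapping.keys v \<subseteq> V \<Longrightarrow> bidegree u = bidegree v \<Longrightarrow>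
      Poly_Mapping.single u 1 - Poly_Mapping.single v 1 \<in> X"
proof (induction "total_degree u" arbitrary: u v rule: less_induct)
  case less
  note D = ideal_mpoly_ringD[OF X]
  note keys = \<open>Poly_Mapping.keys u \<subseteq> V\<close> \<open>Poly_Mapping.keys v \<subseteq> V\<close>
  show ?case
  proof (cases "Poly_Mapping.keys u \<inter> Poly_Mapping.keys v = {}")
    case False
    then obtain x where x: "x \<in> Poly_Mapping.keys u" "x \<in> Poly_Mapping.keys v" by blast
    obtain u' where u': "u = Poly_Mapping.single x 1 + u'" using x(1) by (rule monomial_split1)
    obtain v' where v': "v = Poly_Mapping.single x 1 + v'" using x(2) by (rule monomial_split1)
    have "Poly_Mapping.single u' 1 - Poly_Mapping.single v' 1 \<in> X"
      using less.prems by (intro less.hyps) (auto simp: u' v' total_degree_add keys_add_nat bidegree_add)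
    then have "Var x * (Poly_Mapping.single u' 1 - Poly_Mapping.single v' 1) \<in> X"
      using x keys by (intro D(4) mpoly_closed) auto
    then show ?thesis by (simp add: algebra_simps Var_def mult_single u' v')
  next
    case True
    show ?thesis
    proof (cases "u = 0")
      case u0: True
      have "x \<notin> Poly_Mapping.keys v" for x
        using less.prems(3) bidegree_keys(1)[of "fst x" v] by (cases x) (auto simp: u0)
      then have "Poly_Mapping.keys v = {}" by blast
      then have "v = 0" by simp
      then show ?thesis using u0 D(2) by simp
    next
      case False
      obtain r a b where ab: "alternating_cycle (Poly_Mapping.keys u) (Poly_Mapping.keys v) r a b"
        using alternating_cycle_exists[OF less.prems(3) True False] by blast
      then have "alternating_cycle V V r a b" using keys by (rule alternating_cycle_mono)
      then have f: "alternating_poly r a b \<in> X" by (rule cyc)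
      have inj: "inj_on a {..<r}" "inj_on b {..<r}" and "2 \<le> r" and per: "a r = a 0"
        using ab[unfolded alternating_cycle_def] by (auto dest: spec[of _ 0])
      define u0 v0 where "u0 = (\<Sum>k<r. Poly_Mapping.single (a k, b k) (1::nat))"
        and "v0 = (\<Sum>k<r. Poly_Mapping.single (a (Suc k), b k) (1::nat))"
      \<comment> \<open>Distinct rows and columns make the cycle monomial squarefree, so it divides
        \<open>u\<close> as soon as its variables occur in \<open>u\<close>.\<close>
      have "u0 = (\<Sum>x\<in>(\<lambda>k. (a k, b k)) ` {..<r}. Poly_Mapping.single x 1)"
        unfolding u0_def using inj by (subst sum.reindex) (auto simp: inj_on_def)
      moreover have "(\<lambda>k. (a k, b k)) ` {..<r} \<subseteq> Poly_Mapping.keys u"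
        using ab by (auto simp: alternating_cycle_def)
      then obtain u1 where "u = (\<Sum>x\<in>(\<lambda>k. (a k, b k)) ` {..<r}. Poly_Mapping.single x 1) + u1"
        by (rule monomial_split[OF finite_imageI[OF finite_lessThan]])
      ultimately have u1: "u = u0 + u1" by simp
      have "v0 = (\<Sum>x\<in>(\<lambda>k. (a (Suc k), b k)) ` {..<r}. Poly_Mapping.single x 1)"
        unfolding v0_def using inj by (subst sum.reindex) (auto simp: inj_on_def)
      moreover have "(\<lambda>k. (a (Suc k), b k)) ` {..<r} \<subseteq> Poly_Mapping.keys v"
        using ab by (auto simp: alternating_cycle_def)
      then obtain v1 where "v = (\<Sum>x\<in>(\<lambda>k. (a (Suc k), b k)) ` {..<r}. Poly_Mapping.single x 1) + v1"
        by (rule monomial_split[OF finite_imageI[OF finite_lessThan]])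
      ultimately have v1: "v = v0 + v1" by simp
      have "bidegree u0 = bidegree v0"
        unfolding u0_def v0_def sum_single_bidegree
        using sum_periodic_Suc[of "\<lambda>k. Poly_Mapping.single (False, a k) (1::nat)" r] per by simp
      then have "bidegree u1 = bidegree v1" using less.prems(3) by (simp add: u1 v1 bidegree_add)
      moreover have "total_degree u0 > 0" using \<open>2 \<le> r\<close> by (simp add: u0_def total_degree_sum)
      ultimately have 1: "Poly_Mapping.single u1 1 - Poly_Mapping.single v1 1 \<in> X"
        using keys by (intro less.hyps) (auto simp: u1 v1 total_degree_add keys_add_nat)
      have f': "Poly_Mapping.single u0 1 - Poly_Mapping.single v0 1 \<in> X"
        using f by (simp add: alternating_poly_def prod_Var u0_def v0_def)
      have "Poly_Mapping.single u1 1 * (Poly_Mapping.single u0 1 - Poly_Mapping.single v0 1)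
          + Poly_Mapping.single v0 1 * (Poly_Mapping.single u1 1 - Poly_Mapping.single v1 1) \<in> X"
        using keys by (intro D(3) D(4) f' 1 mpoly_closed) (auto simp: u1 v1 keys_add_nat)
      then show ?thesis by (simp add: algebra_simps mult_single u1 v1)
    qed
  qed
qed

lemma toric_ideal_subset:
  fixes X :: "(vertex, 'k::field) mpoly set"
  assumes "ideal X (mpoly_ring V)"
    and "\<And>r a b. alternating_cycle V V r a b \<Longrightarrow> alternating_poly r a b \<in> X"
  shows "toric_ideal V \<subseteq> X"
  using kernel_push_subset[OF assms(1) binomial_mem_of_cycles[OF assms]]
  by (auto simp: toric_ideal_def)

section \<open>Intervals and cycles\<close>

text \<open>An interval lies in a single row, so the choice of the element is immaterial
  (\<open>row_of_eq\<close>).\<close>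

definition row_of :: "vertex set \<Rightarrow> nat" where
  "row_of H = fst (SOME x. x \<in> H)"

definition col_of :: "vertex set \<Rightarrow> nat" where
  "col_of V = snd (SOME x. x \<in> V)"

lemma row_of_eq: "horizontal_interval D H \<Longrightarrow> x \<in> H \<Longrightarrow> row_of H = fst x"
  unfolding row_of_def horizontal_interval_def by (metis someI_ex)

lemma col_of_eq: "vertical_interval D V \<Longrightarrow> x \<in> V \<Longrightarrow> col_of V = snd x"
  unfolding col_of_def vertical_interval_def by (metis someI_ex)

lemma interval_meet:
  assumes "horizontal_interval D H" "vertical_interval D V" "H \<inter> V \<noteq> {}"
  shows "the_elem (H \<inter> V) = (row_of H, col_of V)" and "(row_of H, col_of V) \<in> verts_of D"
proof -
  obtain x where x: "x \<in> H" "x \<in> V" using assms(3) by blast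
  have "y = (row_of H, col_of V)" if "y \<in> H \<inter> V" for y
    using that row_of_eq[OF assms(1), of y] col_of_eq[OF assms(2), of y] by (auto simp: prod_eq_iff)
  with x have eq: "H \<inter> V = {(row_of H, col_of V)}" by blast
  then show "the_elem (H \<inter> V) = (row_of H, col_of V)" by simp
  have "(row_of H, col_of V) \<in> H" using eq by blast
  then show "(row_of H, col_of V) \<in> verts_of D"
    using assms(1) unfolding horizontal_interval_def by blast
qed

lemma nth_splice:
  assumes "length xs = length ys" "k < length xs"
  shows "splice xs ys ! (2 * k) = xs ! k" "splice xs ys ! Suc (2 * k) = ys ! k"
proof -
  have "\<forall>k < length xs. splice xs ys ! (2 * k) = xs ! k \<and> splice xs ys ! Suc (2 * k) = ys ! k"
    using assms(1)
  proof (induction xs ys rule: list_induct2)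
    case (Cons x xs y ys)
    show ?case
    proof (intro allI impI)
      fix k assume "k < length (x # xs)"
      then show "splice (x # xs) (y # ys) ! (2 * k) = (x # xs) ! k \<and>
          splice (x # xs) (y # ys) ! Suc (2 * k) = (y # ys) ! k"
        using Cons.IH by (cases k) auto
    qed
  qed simp
  then show "splice xs ys ! (2 * k) = xs ! k" "splice xs ys ! Suc (2 * k) = ys ! k"
    using assms(2) by auto
qed

text \<open>In the spliced list, place 2k holds the k-th horizontal and place 2k+1 the k-th vertical
  interval; only the last odd place wraps around.\<close>

lemma Suc_mod_double:
  assumes "k < r"
  shows "(2 * k + 1) mod (2 * r) = Suc (2 * k)" "(Suc (2 * k) + 1) mod (2 * r) = 2 * (Suc k mod r)"
  using assms by (simp, cases "Suc k = r", auto)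

lemma interval_graph_edge:
  "{Inl H, Inr V} \<in> snd (interval_graph D) \<longleftrightarrow>
     H \<in> max_horizontal_intervals D \<and> V \<in> max_vertical_intervals D \<and> H \<inter> V \<noteq> {}"
  "{Inr V, Inl H} \<in> snd (interval_graph D) \<longleftrightarrow>
     H \<in> max_horizontal_intervals D \<and> V \<in> max_vertical_intervals D \<and> H \<inter> V \<noteq> {}"
  by (auto simp: interval_graph_def doubleton_eq_iff)

text \<open>This is stated for an arbitrary set \<open>D\<close> of minors, where several intervals
  may share a row or a column. It therefore claims closure of the index sequence but no distinctness
  of the indices.\<close>

lemma cycle_polysE:
  assumes "f \<in> cycle_polys D"
  obtains r a b where "2 \<le> r" "a r = a 0"
    "\<And>k. k < r \<Longrightarrow> (a k, b k) \<in> verts_of D" "\<And>k. k < r \<Longrightarrow> (a (Suc k), b k) \<in> verts_of D"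
    "f = alternating_poly r a b"
proof -
  from assms obtain hs vs where f: "f = cycle_poly hs vs" and len: "length hs = length vs"
    and cyc: "is_cycle (interval_graph D) (splice (map Inl hs) (map Inr vs))"
    by (auto simp: cycle_polys_def)
  define r where "r = length hs"
  let ?c = "splice (map Inl hs) (map Inr vs)"
  have len_c: "length ?c = 2 * r" by (simp add: r_def len)
  have nth: "?c ! (2 * k) = Inl (hs ! k)" "?c ! Suc (2 * k) = Inr (vs ! k)" if "k < r" for k
    using that len by (simp_all add: nth_splice r_def)
  have r: "2 \<le> r" using cyc len_c by (simp add: is_cycle_def)
  have edge: "{?c ! i, ?c ! ((i + 1) mod (2 * r))} \<in> snd (interval_graph D)" if "i < 2 * r" for i
    using cyc that len_c by (simp add: is_cycle_def)
  have e1: "hs ! k \<in> max_horizontal_intervals D \<and> vs ! k \<in> max_vertical_intervals D \<and> hs ! k \<inter> vs ! k \<noteq> {}"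
    if "k < r" for k
    using edge[of "2 * k"] that nth[of k] Suc_mod_double(1)[OF that] by (simp add: interval_graph_edge)
  have e2: "hs ! (Suc k mod r) \<inter> vs ! k \<noteq> {}" if "k < r" for k
  proof -
    have "Suc k mod r < r" using r by simp
    then show ?thesis
      using edge[of "Suc (2 * k)"] that nth[of k] nth[of "Suc k mod r"] Suc_mod_double(2)[OF that]
      by (simp add: interval_graph_edge)
  qed
  \<comment> \<open>Reduction modulo \<open>r\<close> makes \<open>a r\<close> equal to
    \<open>a 0\<close>, which accounts for the closing edge; \<open>b\<close> is only read below
    \<open>r\<close>.\<close>
  define a b where "a = (\<lambda>k. row_of (hs ! (k mod r)))" and "b = (\<lambda>k. col_of (vs ! k))"
  have int: "horizontal_interval D (hs ! k)" "vertical_interval D (vs ! k)" if "k < r" for k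
    using e1[OF that] by (auto simp: max_horizontal_intervals_def max_vertical_intervals_def)
  have m1: "the_elem (hs ! k \<inter> vs ! k) = (a k, b k)" "(a k, b k) \<in> verts_of D" if "k < r" for k
    using interval_meet[of D "hs ! k" "vs ! k"] int[OF that] e1[OF that] that by (auto simp: a_def b_def)
  have m2: "the_elem (hs ! (Suc k mod r) \<inter> vs ! k) = (a (Suc k), b k)" "(a (Suc k), b k) \<in> verts_of D"
    if "k < r" for k
    using interval_meet[of D "hs ! (Suc k mod r)" "vs ! k"] int[of k] int[of "Suc k mod r"] e2[OF that] that
    by (auto simp: a_def b_def)
  have "f = alternating_poly r a b"
    unfolding f cycle_poly_def alternating_poly_def r_def[symmetric]
    by (intro arg_cong2[of _ _ _ _ "(-)"] prod.cong) (simp_all add: m1 m2)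
  with r m1(2) m2(2) show ?thesis by (intro that[of r a b]) (auto simp: a_def)
qed

lemma cycle_polys_carrier:
  assumes "verts_of D \<subseteq> V"
  shows "cycle_polys D \<subseteq> carrier (mpoly_ring V :: (vertex, 'k::field) mpoly ring)"
proof
  fix f :: "(vertex, 'k) mpoly" assume "f \<in> cycle_polys D"
  then show "f \<in> carrier (mpoly_ring V)"
    by (rule cycle_polysE)
      (use assms in \<open>auto simp: alternating_poly_def intro!: mpoly_closed(6) mpoly_prod_closed mpoly_closed(7)\<close>)
qed

lemma cycle_polys_toric:
  assumes "verts_of D \<subseteq> V"
  shows "cycle_polys D \<subseteq> (toric_ideal V :: (vertex, 'k::field) mpoly set)"
proof
  fix f :: "(vertex, 'k) mpoly" assume f: "f \<in> cycle_polys D"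
  then obtain r a b where r: "a r = a 0" and f': "f = alternating_poly r a b" by (rule cycle_polysE)
  have "push bidegree f = 0"
    unfolding f' alternating_poly_def prod_Var push_diff push_single sum_single_bidegree
    using sum_periodic_Suc[of "\<lambda>k. Poly_Mapping.single (False, a k) (1::nat)" r] r by simp
  then show "f \<in> toric_ideal V"
    using f cycle_polys_carrier[OF assms] by (auto simp: toric_ideal_def)
qed

lemma cycle_polys_keys:
  assumes "f \<in> cycle_polys D" "t \<in> Poly_Mapping.keys f"
  shows "2 \<le> total_degree t"
proof -
  obtain r a b where "2 \<le> r" "f = alternating_poly r a b" using assms(1) by (rule cycle_polysE)
  moreover define u v where "u = (\<Sum>k<r. Poly_Mapping.single (a k, b k) (1::nat))"
    and "v = (\<Sum>k<r. Poly_Mapping.single (a (Suc k), b k) (1::nat))"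
  ultimately have "f = Poly_Mapping.single u 1 - Poly_Mapping.single v 1"
    by (simp add: alternating_poly_def prod_Var)
  then have "t = u \<or> t = v"
    using assms(2) keys_diff[of "Poly_Mapping.single u (1::'a)" "Poly_Mapping.single v 1"] by auto
  then show ?thesis using \<open>2 \<le> r\<close> by (auto simp: u_def v_def total_degree_sum)
qed

lemma path_connected_through:
  assumes "x = c \<or> {c, x} \<in> E" "y = c \<or> {c, y} \<in> E"
  shows "path_connected_by E x y"
proof -
  have "(x, c) \<in> {(u, v). {u, v} \<in> E}\<^sup>*" using assms(1) by (auto simp: insert_commute)
  moreover have "(c, y) \<in> {(u, v). {u, v} \<in> E}\<^sup>*" using assms(2) by auto
  ultimately show ?thesis unfolding path_connected_by_def by (rule rtrancl_trans)
qed

lemma is_cycle_delete_verts: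
  "is_cycle (delete_verts G X) c \<longleftrightarrow> is_cycle G c \<and> set c \<inter> X = {}"
proof -
  have "c ! ((i + 1) mod length c) \<in> set c" if "i < length c" for i
    using that by (intro nth_mem mod_less_divisor) linarith
  then have "{c ! i, c ! ((i + 1) mod length c)} \<inter> X = {}" if "i < length c" "set c \<inter> X = {}" for i
    using that nth_mem by blast
  then show ?thesis
    unfolding is_cycle_def delete_verts_def by auto
qed

section \<open>Corner minors\<close>

locale corner_minors =
  fixes C :: "minor set" and m n :: nat
  assumes C_minors: "C \<subseteq> two_minors m n" and C_corner: "\<forall>d\<in>C. corner_minor d"
begin

abbreviation "verts \<equiv> verts_of C"

lemma cornerE:
  assumes "d \<in> C"
  obtains a b where "d = (1, a, 1, b)" "1 < a" "1 < b"
  using C_minors[THEN subsetD, OF assms] C_corner[THEN bspec, OF assms] that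
  by (cases d) (auto simp: two_minors_def)

lemma corner_gt: "(1, a, 1, b) \<in> C \<Longrightarrow> 1 < a \<and> 1 < b"
  using C_minors by (auto simp: two_minors_def)

lemma finite_C: "finite C"
proof (rule finite_subset[OF C_minors])
  show "finite (two_minors m n)"
    by (rule finite_subset[of _ "{..m} \<times> {..m} \<times> {..n} \<times> {..n}"]) (auto simp: two_minors_def)
qed

lemma finite_verts: "finite verts"
proof -
  have "finite (minor_verts d)" for d by (cases d) simp
  then show ?thesis using finite_C by (auto simp: verts_of_def)
qed

section \<open>Vertices and intervals of a set of corner minors\<close>

lemma verts_iff:
  "(a, b) \<in> verts \<longleftrightarrow> (\<exists>a' b'. (1, a', 1, b') \<in> C \<and> (a = 1 \<or> a = a') \<and> (b = 1 \<or> b = b'))"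
proof
  assume "(a, b) \<in> verts"
  then obtain d where d: "d \<in> C" "(a, b) \<in> minor_verts d" by (auto simp: verts_of_def)
  obtain a' b' where "d = (1, a', 1, b')" using d(1) by (rule cornerE)
  with d show "\<exists>a' b'. (1, a', 1, b') \<in> C \<and> (a = 1 \<or> a = a') \<and> (b = 1 \<or> b = b')"
    by auto
qed (force simp: verts_of_def)

lemma verts_corner: "(a, b) \<in> verts \<Longrightarrow> (a, 1) \<in> verts" "(a, b) \<in> verts \<Longrightarrow> (1, b) \<in> verts"
  "(a, b) \<in> verts \<Longrightarrow> (1, 1) \<in> verts"
  by (auto simp: verts_iff)

lemma minor_of_vert: "(a, b) \<in> verts \<Longrightarrow> a \<noteq> 1 \<Longrightarrow> b \<noteq> 1 \<Longrightarrow> (1, a, 1, b) \<in> C"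
  by (auto simp: verts_iff)

lemma minor_verts_subset: "d \<in> C \<Longrightarrow> minor_verts d \<subseteq> verts"
  by (auto simp: verts_of_def)

text \<open>Every vertex (a, b) with b different from 1 is joined to (a, 1) by a horizontal edge of
  a corner minor. Each row of the vertex set is thus connected through its border vertex and is a
  single maximal interval. Columns behave alike, with (1, b) as centre.\<close>

lemma max_horizontal: "max_horizontal_intervals C = (\<lambda>a. {x \<in> verts. fst x = a}) ` fst ` verts"
proof -
  have hedge: "{(a, 1), (a, b)} \<in> hedges_of C" if ab: "(a, b) \<in> verts" "b \<noteq> 1" for a b
  proof -
    obtain a' where "(1, a', 1, b) \<in> C" "a = 1 \<or> a = a'" using ab by (auto simp: verts_iff)
    then show ?thesis by (force simp: hedges_of_def)
  qed
  have int: "horizontal_interval C {x \<in> verts. fst x = a}" if "a \<in> fst ` verts" for a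
    unfolding horizontal_interval_def
  proof (intro conjI ballI)
    show "{x \<in> verts. fst x = a} \<noteq> {}" using that by auto
    fix x y assume "x \<in> {x \<in> verts. fst x = a}" "y \<in> {x \<in> verts. fst x = a}"
    then show "path_connected_by (hedges_of C) x y"
      using hedge[of a "snd x"] hedge[of a "snd y"]
      by (intro path_connected_through[of _ "(a, 1)"]) (cases x, cases y, auto)+
  qed auto
  have sub: "\<exists>a\<in>fst ` verts. H \<subseteq> {x \<in> verts. fst x = a}" if "horizontal_interval C H" for H
    using that unfolding horizontal_interval_def by fast
  show ?thesis
  proof (intro equalityI subsetI)
    fix H assume H: "H \<in> max_horizontal_intervals C"
    then have "horizontal_interval C H" by (simp add: max_horizontal_intervals_def)
    then obtain a where "a \<in> fst ` verts" "H \<subseteq> {x \<in> verts. fst x = a}"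
      using sub[of H] by blast
    then show "H \<in> (\<lambda>a. {x \<in> verts. fst x = a}) ` fst ` verts"
      using H int by (auto simp: max_horizontal_intervals_def)
  next
    fix H assume "H \<in> (\<lambda>a. {x \<in> verts. fst x = a}) ` fst ` verts"
    then obtain a where a: "a \<in> fst ` verts" "H = {x \<in> verts. fst x = a}" by blast
    have "\<not> H \<subset> H'" if H': "horizontal_interval C H'" for H'
    proof
      assume "H \<subset> H'"
      moreover obtain a' where "H' \<subseteq> {x \<in> verts. fst x = a'}" using sub[OF H'] by blast
      moreover obtain x where "x \<in> H" using a by auto
      ultimately show False using a by auto
    qed
    then show "H \<in> max_horizontal_intervals C"
      using int[OF a(1)] a(2) by (auto simp: max_horizontal_intervals_def)
  qed
qed

lemma max_vertical: "max_vertical_intervals C = (\<lambda>b. {x \<in> verts. snd x = b}) ` snd ` verts"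
proof -
  have vedge: "{(1, b), (a, b)} \<in> vedges_of C" if ab: "(a, b) \<in> verts" "a \<noteq> 1" for a b
  proof -
    obtain b' where "(1, a, 1, b') \<in> C" "b = 1 \<or> b = b'" using ab by (auto simp: verts_iff)
    then show ?thesis by (force simp: vedges_of_def)
  qed
  have int: "vertical_interval C {x \<in> verts. snd x = b}" if "b \<in> snd ` verts" for b
    unfolding vertical_interval_def
  proof (intro conjI ballI)
    show "{x \<in> verts. snd x = b} \<noteq> {}" using that by auto
    fix x y assume "x \<in> {x \<in> verts. snd x = b}" "y \<in> {x \<in> verts. snd x = b}"
    then show "path_connected_by (vedges_of C) x y"
      using vedge[of "fst x" b] vedge[of "fst y" b]
      by (intro path_connected_through[of _ "(1, b)"]) (cases x, cases y, auto)+
  qed auto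
  have sub: "\<exists>b\<in>snd ` verts. V \<subseteq> {x \<in> verts. snd x = b}" if "vertical_interval C V" for V
    using that unfolding vertical_interval_def by fast
  show ?thesis
  proof (intro equalityI subsetI)
    fix V assume V: "V \<in> max_vertical_intervals C"
    then have "vertical_interval C V" by (simp add: max_vertical_intervals_def)
    then obtain b where "b \<in> snd ` verts" "V \<subseteq> {x \<in> verts. snd x = b}"
      using sub[of V] by blast
    then show "V \<in> (\<lambda>b. {x \<in> verts. snd x = b}) ` snd ` verts"
      using V int by (auto simp: max_vertical_intervals_def)
  next
    fix V assume "V \<in> (\<lambda>b. {x \<in> verts. snd x = b}) ` snd ` verts"
    then obtain b where b: "b \<in> snd ` verts" "V = {x \<in> verts. snd x = b}" by blast
    have "\<not> V \<subset> V'" if V': "vertical_interval C V'" for V'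
    proof
      assume "V \<subset> V'"
      moreover obtain b' where "V' \<subseteq> {x \<in> verts. snd x = b'}" using sub[OF V'] by blast
      moreover obtain x where "x \<in> V" using b by auto
      ultimately show False using b by auto
    qed
    then show "V \<in> max_vertical_intervals C"
      using int[OF b(1)] b(2) by (auto simp: max_vertical_intervals_def)
  qed
qed

text \<open>The way back from index sequences to graph cycles. It relies on intervals being whole
  rows and columns: distinct indices give distinct intervals, and a vertex (a, b) is exactly an edge
  of the graph.\<close>

lemma interval_cycle:
  assumes "alternating_cycle verts verts r a b"
  defines "hs \<equiv> map (\<lambda>k. {x \<in> verts. fst x = a k}) [0..<r]"
    and "vs \<equiv> map (\<lambda>k. {x \<in> verts. snd x = b k}) [0..<r]"
  shows "is_cycle (interval_graph C) (splice (map Inl hs) (map Inr vs))"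
    and "cycle_poly hs vs = alternating_poly r a b"
proof -
  let ?c = "splice (map Inl hs) (map Inr vs)"
  have r: "2 \<le> r" and inj: "inj_on a {..<r}" "inj_on b {..<r}" and per: "\<And>k. a (k + r) = a k"
    and U: "\<And>k. (a k, b k) \<in> verts" and V: "\<And>k. (a (Suc k), b k) \<in> verts"
    using assms(1) unfolding alternating_cycle_def by auto
  have mod: "a (Suc k mod r) = a (Suc k)" if "k < r" for k
    using that per[of 0] by (cases "Suc k = r") auto
  have len: "length hs = r" "length vs = r" by (simp_all add: hs_def vs_def)
  have nths: "hs ! k = {x \<in> verts. fst x = a k}" "vs ! k = {x \<in> verts. snd x = b k}" if "k < r" for k
    using that by (simp_all add: hs_def vs_def)
  have nth: "?c ! (2 * k) = Inl {x \<in> verts. fst x = a k}" "?c ! Suc (2 * k) = Inr {x \<in> verts. snd x = b k}"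
    if "k < r" for k
    using that by (simp_all add: nth_splice len nths)
  have meet: "{x \<in> verts. fst x = a'} \<inter> {x \<in> verts. snd x = b'} = {(a', b')}" if "(a', b') \<in> verts" for a' b'
    using that by auto
  have int: "{x \<in> verts. fst x = a k} \<in> max_horizontal_intervals C"
    "{x \<in> verts. snd x = b k} \<in> max_vertical_intervals C" for k
    using U[of k] by (force simp: max_horizontal max_vertical)+
  have rows: "{x \<in> verts. fst x = a k} = {x \<in> verts. fst x = a l} \<longleftrightarrow> a k = a l" for k l
    using U[of k] by auto
  have cols: "{x \<in> verts. snd x = b k} = {x \<in> verts. snd x = b l} \<longleftrightarrow> b k = b l" for k l
    using U[of k] by auto
  have dist: "distinct hs" "distinct vs"
    unfolding hs_def vs_def distinct_map
    using inj by (simp_all add: inj_on_def rows cols)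
  have set: "set ?c = Inl ` set hs \<union> Inr ` set vs"
    by (simp add: set_shuffles[OF splice_in_shuffles])
  have "?c \<in> shuffles (map Inl hs) (map Inr vs)" by (rule splice_in_shuffles)
  then have "distinct ?c"
    by (rule distinct_disjoint_shuffles[rotated -1]) (auto simp: distinct_map dist inj_on_def)
  moreover have "{?c ! i, ?c ! ((i + 1) mod (2 * r))} \<in> snd (interval_graph C)" if i: "i < 2 * r" for i
  proof -
    have edge: "{Inl {x \<in> verts. fst x = a k}, Inr {x \<in> verts. snd x = b l}} \<in> snd (interval_graph C)"
      if "(a k, b l) \<in> verts" for k l
      using int(1)[of k] int(2)[of l] that by (auto simp: interval_graph_edge meet)
    show ?thesis
    proof (cases "even i")
      case True
      then obtain k where k: "i = 2 * k" by blast
      then have "k < r" using i by simp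
      then show ?thesis
        using edge[OF U[of k]] Suc_mod_double(1)[of k r] nth[of k] by (simp add: k)
    next
      case False
      then obtain k where k: "i = Suc (2 * k)" by (auto elim: oddE)
      then have kr: "k < r" "Suc k mod r < r" using i r by simp_all
      then have "(a (Suc k mod r), b k) \<in> verts" using V mod by simp
      from edge[OF this] show ?thesis
        using Suc_mod_double(2)[of k r] nth(1)[of "Suc k mod r"] nth(2)[of k] kr
        by (simp add: k insert_commute[of "Inr _"])
    qed
  qed
  moreover have "length ?c = 2 * r" by (simp add: len)
  moreover have "set ?c \<subseteq> fst (interval_graph C)"
    unfolding set interval_graph_def using int by (auto simp: hs_def vs_def)
  ultimately show "is_cycle (interval_graph C) ?c" unfolding is_cycle_def using r by simp
  show "cycle_poly hs vs = alternating_poly r a b"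
    unfolding cycle_poly_def alternating_poly_def len
    using r by (intro arg_cong2[of _ _ _ _ "(-)"] prod.cong) (simp_all add: nths meet U V mod)
qed

lemma alternating_poly_mem_cycle_polys:
  "alternating_cycle verts verts r a b \<Longrightarrow> alternating_poly r a b \<in> cycle_polys C"
  using interval_cycle[of r a b] unfolding cycle_polys_def by (metis (mono_tags, lifting) length_map mem_Collect_eq)

section \<open>Relations modulo I(C) and multiplication by the corner variable\<close>

lemma minor_ring_eq: "minor_ring C = mpoly_ring verts"
  by (simp add: minor_ring_def)

lemma minor_poly_carrier: "minor_poly ` C \<subseteq> carrier (mpoly_ring verts :: (vertex, 'k::field) mpoly ring)"
proof
  fix f :: "(vertex, 'k) mpoly" assume "f \<in> minor_poly ` C"
  then obtain d where d: "d \<in> C" "f = minor_poly d" by blast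
  obtain a1 a2 b1 b2 where [simp]: "d = (a1, a2, b1, b2)" by (cases d)
  show "f \<in> carrier (mpoly_ring verts)"
    using minor_verts_subset[OF d(1)] d(2) by (auto intro!: mpoly_closed(4,6,7))
qed

lemma ideal_minor_ideal: "ideal (minor_ideal C :: (vertex, 'k::field) mpoly set) (mpoly_ring verts)"
proof -
  interpret cring "mpoly_ring verts :: (vertex, 'k) mpoly ring" by (rule cring_mpoly_ring)
  show ?thesis unfolding minor_ideal_def minor_ring_eq by (rule genideal_ideal[OF minor_poly_carrier])
qed

lemma minor_ideal_subset:
  fixes X :: "(vertex, 'k::field) mpoly set"
  assumes "ideal X (mpoly_ring verts)"
    and "\<And>a b. (1, a, 1, b) \<in> C \<Longrightarrow> Var (1, 1) * Var (a, b) - Var (1, b) * Var (a, 1) \<in> X"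
  shows "minor_ideal C \<subseteq> X"
proof -
  interpret cring "mpoly_ring verts :: (vertex, 'k) mpoly ring" by (rule cring_mpoly_ring)
  have "minor_poly d \<in> X" if "d \<in> C" for d
  proof -
    obtain a b where "d = (1, a, 1, b)" using \<open>d \<in> C\<close> by (rule cornerE)
    then show ?thesis using assms(2) that by simp
  qed
  then show ?thesis
    unfolding minor_ideal_def minor_ring_eq using assms(1) by (intro genideal_minimal) auto
qed

lemma Var_carrier:
  assumes "(a, b) \<in> verts"
  shows "Var (a, b) \<in> carrier (mpoly_ring verts :: (vertex, 'k::field) mpoly ring)"
    and "Var (a, 1) \<in> carrier (mpoly_ring verts :: (vertex, 'k) mpoly ring)"
    and "Var (1, b) \<in> carrier (mpoly_ring verts :: (vertex, 'k) mpoly ring)"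
    and "Var (1, 1) \<in> carrier (mpoly_ring verts :: (vertex, 'k) mpoly ring)"
  using assms verts_corner[OF assms] by (auto intro: mpoly_closed(7))

text \<open>The generators of I(C) extended to all vertices: on the border, where a = 1 or b = 1,
  the expression is identically zero.\<close>

lemma corner_relation:
  assumes "(a, b) \<in> verts"
  shows "Var (1, 1) * Var (a, b) - Var (a, 1) * Var (1, b) \<in> (minor_ideal C :: (vertex, 'k::field) mpoly set)"
proof (cases "a = 1 \<or> b = 1")
  case False
  interpret cring "mpoly_ring verts :: (vertex, 'k) mpoly ring" by (rule cring_mpoly_ring)
  have "minor_poly (1, a, 1, b) \<in> (minor_ideal C :: (vertex, 'k) mpoly set)"
    unfolding minor_ideal_def minor_ring_eq
    using minor_of_vert[OF assms] False genideal_self[OF minor_poly_carrier] by blast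
  then show ?thesis by (simp add: mult.commute)
qed (auto simp: mult.commute ideal_mpoly_ringD(2)[OF ideal_minor_ideal])

text \<open>Modulo I(C) both products, multiplied by x_11, become x_a1 x_1b x_1b'. So x_11 moves
  minors into I(C) that need not be corner minors, and these are the steps of the
  telescoping.\<close>

lemma row_relation:
  assumes "(a, b) \<in> verts" "(a, b') \<in> verts"
  shows "Var (1, 1) * (Var (1, b) * Var (a, b') - Var (a, b) * Var (1, b'))
    \<in> (minor_ideal C :: (vertex, 'k::field) mpoly set)"
proof -
  note D = ideal_mpoly_ringD[OF ideal_minor_ideal[where 'k = 'k]]
  have "Var (1, b) * (Var (1, 1) * Var (a, b') - Var (a, 1) * Var (1, b'))
      - Var (1, b') * (Var (1, 1) * Var (a, b) - Var (a, 1) * Var (1, b))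
      \<in> (minor_ideal C :: (vertex, 'k) mpoly set)"
    using assms by (intro D(4,6) corner_relation Var_carrier)
  then show ?thesis by (simp add: algebra_simps)
qed

lemma col_relation:
  assumes "(a, b) \<in> verts" "(a', b) \<in> verts"
  shows "Var (1, 1) * (Var (a, 1) * Var (a', b) - Var (a, b) * Var (a', 1))
    \<in> (minor_ideal C :: (vertex, 'k::field) mpoly set)"
proof -
  note D = ideal_mpoly_ringD[OF ideal_minor_ideal[where 'k = 'k]]
  have "Var (a, 1) * (Var (1, 1) * Var (a', b) - Var (a', 1) * Var (1, b))
      - Var (a', 1) * (Var (1, 1) * Var (a, b) - Var (a, 1) * Var (1, b))
      \<in> (minor_ideal C :: (vertex, 'k) mpoly set)"
    using assms by (intro D(4,6) corner_relation Var_carrier)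
  then show ?thesis by (simp add: algebra_simps)
qed

text \<open>Rotates the cycle so that a place \<open>j\<close> lying in row 1 or column 1 becomes
  place 0; the binomial does not change.\<close>

lemma alternating_cycle_shift:
  assumes "alternating_cycle verts verts r a b"
  shows "\<And>k. (a (k + j), b (k + j)) \<in> verts" "\<And>k. (a (Suc k + j), b (k + j)) \<in> verts"
    "a (r + j) = a (0 + j)" "b (r + j) = b (0 + j)"
    "alternating_poly r (\<lambda>k. a (k + j)) (\<lambda>k. b (k + j)) = (alternating_poly r a b :: (vertex, 'k::field) mpoly)"
proof -
  have per: "a (k + r) = a k" "b (k + r) = b k" for k
    using assms by (auto simp: alternating_cycle_def)
  show "\<And>k. (a (k + j), b (k + j)) \<in> verts" "\<And>k. (a (Suc k + j), b (k + j)) \<in> verts"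
    using assms by (auto simp: alternating_cycle_def)
  show "a (r + j) = a (0 + j)" "b (r + j) = b (0 + j)" using per[of j] by (simp_all add: add.commute)
  have "a (Suc (k + r)) = a (Suc k)" for k using per(1)[of "Suc k"] by simp
  then show "alternating_poly r (\<lambda>k. a (k + j)) (\<lambda>k. b (k + j)) = (alternating_poly r a b :: (vertex, 'k) mpoly)"
    using prod_periodic_shift[of "\<lambda>k. Var (a k, b k) :: (vertex, 'k) mpoly" r j]
      prod_periodic_shift[of "\<lambda>k. Var (a (Suc k), b k) :: (vertex, 'k) mpoly" r j] per
    by (simp add: alternating_poly_def)
qed

text \<open>The marker is x_{1,b_k}. It starts as x_{a_0,b_0}, a factor of the one monomial, and
  ends after r - 1 steps as the factor of the other monomial that belongs to the closing edge, since
  \<open>a r = a 0 = 1\<close>.\<close>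

lemma corner_times_cycle_row:
  assumes U: "\<And>k. (a k, b k) \<in> verts" and V: "\<And>k. (a (Suc k), b k) \<in> verts"
    and "0 < r" "a r = a 0" "a 0 = 1"
  shows "Var (1, 1) * alternating_poly r a b \<in> (minor_ideal C :: (vertex, 'k::field) mpoly set)"
proof -
  obtain j where j: "r = Suc j" using \<open>0 < r\<close> by (cases r) auto
  have "Var (1, 1) * (Var (1, b 0) * (\<Prod>k<j. Var (a (Suc k), b (Suc k)))
      - (\<Prod>k<j. Var (a (Suc k), b k)) * Var (1, b j)) \<in> (minor_ideal C :: (vertex, 'k) mpoly set)"
    by (rule ideal_telescope[OF ideal_minor_ideal]) (intro Var_carrier row_relation U V)+
  then show ?thesis
    using assms(4,5)
    by (simp add: j alternating_poly_def prod.lessThan_Suc_shift[of "\<lambda>k. Var (a k, b k)"]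
        prod.lessThan_Suc[of "\<lambda>k. Var (a (Suc k), b k)"] del: prod.lessThan_Suc)
qed

lemma corner_times_cycle_col:
  assumes U: "\<And>k. (a k, b k) \<in> verts" and V: "\<And>k. (a (Suc k), b k) \<in> verts"
    and "0 < r" "a r = a 0" "b r = b 0" "b 0 = 1"
  shows "Var (1, 1) * alternating_poly r a b \<in> (minor_ideal C :: (vertex, 'k::field) mpoly set)"
proof -
  obtain j where j: "r = Suc j" using \<open>0 < r\<close> by (cases r) auto
  have "Var (1, 1) * (Var (a (Suc 0), 1) * (\<Prod>k<j. Var (a (Suc (Suc k)), b (Suc k)))
      - (\<Prod>k<j. Var (a (Suc k), b (Suc k))) * Var (a (Suc j), 1)) \<in> (minor_ideal C :: (vertex, 'k) mpoly set)"
    by (rule ideal_telescope[OF ideal_minor_ideal]) (intro Var_carrier col_relation U V)+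
  \<comment> \<open>With the marker in column 1 the chain starts at x_{a_1,b_0}, a factor of the
    second monomial, so the sign is reversed. The first monomial is rewritten with all indices
    raised by one to match the chain.\<close>
  then have "- (Var (1, 1) * (Var (a (Suc 0), 1) * (\<Prod>k<j. Var (a (Suc (Suc k)), b (Suc k)))
      - (\<Prod>k<j. Var (a (Suc k), b (Suc k))) * Var (a (Suc j), 1))) \<in> (minor_ideal C :: (vertex, 'k) mpoly set)"
    by (rule ideal_mpoly_ringD(5)[OF ideal_minor_ideal])
  moreover have "(\<Prod>k<r. Var (a k, b k)) = (\<Prod>k<r. Var (a (Suc k), b (Suc k)) :: (vertex, 'k) mpoly)"
    using prod_periodic_Suc[of "\<lambda>k. Var (a k, b k) :: (vertex, 'k) mpoly" r] assms(4,5) by simp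
  ultimately show ?thesis
    using assms(5,6)
    by (simp add: j alternating_poly_def prod.lessThan_Suc_shift[of "\<lambda>k. Var (a (Suc k), b k)"]
        prod.lessThan_Suc[of "\<lambda>k. Var (a (Suc k), b (Suc k))"] right_diff_distrib del: prod.lessThan_Suc)
qed

lemma corner_times_cycle:
  assumes cyc: "alternating_cycle verts verts r a b" and "a j = 1 \<or> b j = 1"
  shows "Var (1, 1) * alternating_poly r a b \<in> (minor_ideal C :: (vertex, 'k::field) mpoly set)"
proof -
  note S = alternating_cycle_shift[OF cyc, where j = j]
  have "0 < r" using cyc by (simp add: alternating_cycle_def)
  have "Var (1, 1) * alternating_poly r (\<lambda>k. a (k + j)) (\<lambda>k. b (k + j))
      \<in> (minor_ideal C :: (vertex, 'k) mpoly set)"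
    using assms(2)
  proof
    assume "a j = 1"
    then show ?thesis by (intro corner_times_cycle_row S \<open>0 < r\<close>) simp_all
  next
    assume "b j = 1"
    then show ?thesis by (intro corner_times_cycle_col S \<open>0 < r\<close>) simp_all
  qed
  then show ?thesis unfolding S(5) .
qed

text \<open>The polynomials that x_11 multiplies into I(C) form an ideal, so only the cycle
  binomials have to be checked. By acyclicity each of these cycles visits row 1 or column 1.\<close>

lemma corner_times_toric:
  assumes H1: "(1, 1) \<in> H1" and V1: "(1, 1) \<in> V1"
    and acyclic: "\<not> (\<exists>c. is_cycle (delete_verts (interval_graph C) {Inr V1, Inl H1}) c)"
    and p: "p \<in> toric_ideal verts"
  shows "Var (1, 1) * p \<in> (minor_ideal C :: (vertex, 'k::field) mpoly set)"
proof -
  note D = ideal_mpoly_ringD[OF ideal_minor_ideal[where 'k = 'k]]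
  let ?X = "{p \<in> carrier (mpoly_ring verts). Var (1, 1) * p \<in> (minor_ideal C :: (vertex, 'k) mpoly set)}"
  have "ideal ?X (mpoly_ring verts)"
  proof (rule ideal_mpoly_ringI)
    fix r q :: "(vertex, 'k) mpoly" assume r: "r \<in> carrier (mpoly_ring verts)" and q: "q \<in> ?X"
    have "r * (Var (1, 1) * q) \<in> minor_ideal C" by (rule D(4)[OF r]) (use q in blast)
    then show "r * q \<in> ?X" using r q by (simp add: mpoly_closed mult.left_commute)
  qed (use D(2,3) in \<open>auto simp: mpoly_closed distrib_left\<close>)
  moreover have "alternating_poly r a b \<in> ?X" if cyc: "alternating_cycle verts verts r a b" for r a b
  proof -
    have "\<exists>j. a j = 1 \<or> b j = 1"
    proof (rule ccontr)
      assume no: "\<not> ?thesis"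
      define hs vs where "hs = map (\<lambda>k. {x \<in> verts. fst x = a k}) [0..<r]"
        and "vs = map (\<lambda>k. {x \<in> verts. snd x = b k}) [0..<r]"
      let ?c = "splice (map Inl hs) (map Inr vs) :: (vertex set + vertex set) list"
      have "set ?c = Inl ` set hs \<union> Inr ` set vs"
        by (simp add: set_shuffles[OF splice_in_shuffles])
      \<comment> \<open>Both intervals contain (1, 1), whereas the rows and columns of this cycle
        all have an index other than 1.\<close>
      moreover have "H1 \<notin> set hs" "V1 \<notin> set vs" using no H1 V1 by (auto simp: hs_def vs_def)
      ultimately have "set ?c \<inter> {Inr V1, Inl H1} = {}" by auto
      then have "is_cycle (delete_verts (interval_graph C) {Inr V1, Inl H1}) ?c"
        using interval_cycle(1)[OF cyc] by (simp add: is_cycle_delete_verts hs_def vs_def)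
      then show False using acyclic by blast
    qed
    then obtain j where "a j = 1 \<or> b j = 1" by blast
    moreover have "alternating_poly r a b \<in> carrier (mpoly_ring verts)"
      using alternating_poly_mem_cycle_polys[OF cyc] cycle_polys_carrier by blast
    ultimately show ?thesis using corner_times_cycle[OF cyc, of j, where 'k = 'k] by simp
  qed
  ultimately have "toric_ideal verts \<subseteq> ?X" by (rule toric_ideal_subset)
  then show ?thesis using p by blast
qed

section \<open>Cycles away from the corner obstruct radicality\<close>

text \<open>Exchanges starting from x_11 u spend its only x_11, and afterwards the only exchange
  possible is the reverse one; so the class of x_11 u consists of x_11 u and its direct neighbours.
  Each neighbour contains some x_a1 with a > 1, which x_11 v does not, so the class separates the
  two monomials.\<close>

lemma corner_times_binomial_notin:
  assumes u: "\<And>x. x \<in> Poly_Mapping.keys u \<Longrightarrow> fst x \<noteq> 1 \<and> snd x \<noteq> 1"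
    and v: "\<And>x. x \<in> Poly_Mapping.keys v \<Longrightarrow> fst x \<noteq> 1 \<and> snd x \<noteq> 1" and "u \<noteq> v"
  shows "Var (1, 1) * (Poly_Mapping.single u 1 - Poly_Mapping.single v 1)
    \<notin> (minor_ideal C :: (vertex, 'k::field) mpoly set)"
proof
  define e :: "nat \<Rightarrow> nat \<Rightarrow> vertex \<Rightarrow>\<^sub>0 nat" where "e a b = Poly_Mapping.single (a, b) 1" for a b
  have ke: "Poly_Mapping.keys (e a b) = {(a, b)}" for a b by (simp add: e_def)
  \<comment> \<open>The class of \<open>x\<^sub>1\<^sub>1 u\<close> under exchanging \<open>x\<^sub>1\<^sub>1 x\<^sub>a\<^sub>b\<close> and \<open>x\<^sub>1\<^sub>b x\<^sub>a\<^sub>1\<close>: the sum of the coefficients over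
    such a class vanishes on the ideal.\<close>
  define S where "S = {e 1 1 + u} \<union> {t. \<exists>a b s. (1, a, 1, b) \<in> C \<and> u = e a b + s \<and> t = e a 1 + e 1 b + s}"
  define L :: "(vertex, 'k) mpoly \<Rightarrow> 'k" where
    "L p = Poly_Mapping.lookup (push (\<lambda>t. t \<in> S) p) True" for p
  have L_add: "L (p + q) = L p + L q" and L_diff: "L (p - q) = L p - L q" for p q
    by (simp_all add: L_def push_add push_diff lookup_add lookup_minus)
  have L_single: "L (Poly_Mapping.single t c) = (if t \<in> S then c else 0)" for t c
    by (simp add: L_def lookup_single when_def)
  have L_sum: "L (sum f A) = (\<Sum>i\<in>A. L (f i))" for f and A :: "(vertex \<Rightarrow>\<^sub>0 nat) set"
    by (simp add: L_def push_sum lookup_sum)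
  \<comment> \<open>Closure of \<open>S\<close> under exchanges in both directions. Since
    \<open>s\<close> divides \<open>u\<close>, it has no variable in row 1 or column 1, so an
    exchange leading back from a neighbour must use the same \<open>a\<close> and \<open>b\<close>;
    the remaining cases contradict the supports.\<close>
  have S: "t + e 1 1 + e a b \<in> S \<longleftrightarrow> t + e 1 b + e a 1 \<in> S" if ab: "(1, a, 1, b) \<in> C" for t a b
  proof
    have gt: "1 < a" "1 < b" using corner_gt[OF ab] by auto
    {
      assume "t + e 1 1 + e a b \<in> S"
      then consider "t + e 1 1 + e a b = e 1 1 + u"
        | a' b' s where "(1, a', 1, b') \<in> C" "u = e a' b' + s" "t + e 1 1 + e a b = e a' 1 + e 1 b' + s"
        unfolding S_def by blast
      then show "t + e 1 b + e a 1 \<in> S"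
      proof cases
        case 1
        then have "e 1 1 + u = e 1 1 + (e a b + t)" by (simp only: ac_simps)
        then have "u = e a b + t" by (simp only: add_left_cancel)
        moreover have "t + e 1 b + e a 1 = e a 1 + e 1 b + t" by (simp only: ac_simps)
        ultimately show ?thesis using ab unfolding S_def by blast
      next
        case 2
        have "(1, 1) \<in> Poly_Mapping.keys (t + e 1 1 + e a b)" by (simp add: keys_add_nat ke)
        then have "(1, 1) \<in> Poly_Mapping.keys s"
          unfolding 2(3) using corner_gt[OF 2(1)] by (auto simp: keys_add_nat ke)
        then show ?thesis using u[of "(1, 1)"] by (simp add: 2(2) keys_add_nat)
      qed
    next
      assume "t + e 1 b + e a 1 \<in> S"
      then consider "t + e 1 b + e a 1 = e 1 1 + u"
        | a' b' s where "(1, a', 1, b') \<in> C" "u = e a' b' + s" "t + e 1 b + e a 1 = e a' 1 + e 1 b' + s"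
        unfolding S_def by blast
      then show "t + e 1 1 + e a b \<in> S"
      proof cases
        case 1
        have "(a, 1) \<in> Poly_Mapping.keys (t + e 1 b + e a 1)" by (simp add: keys_add_nat ke)
        then have "(a, 1) \<in> Poly_Mapping.keys u"
          unfolding 1 using gt by (auto simp: keys_add_nat ke)
        then show ?thesis using u[of "(a, 1)"] by simp
      next
        case 2
        have mem: "(a, 1) \<in> Poly_Mapping.keys (t + e 1 b + e a 1)" "(1, b) \<in> Poly_Mapping.keys (t + e 1 b + e a 1)"
          by (simp_all add: keys_add_nat ke)
        have "(a, 1) \<notin> Poly_Mapping.keys s" "(1, b) \<notin> Poly_Mapping.keys s"
          using u[of "(a, 1)"] u[of "(1, b)"] by (auto simp: 2(2) keys_add_nat)
        then have eq: "a' = a" "b' = b"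
          using mem gt corner_gt[OF 2(1)] unfolding 2(3) by (auto simp: keys_add_nat ke)
        have "e a 1 + e 1 b + t = e a 1 + e 1 b + s" using 2(3) unfolding eq by (simp only: ac_simps)
        then have "t = s" by (simp only: add_left_cancel)
        then have "t + e 1 1 + e a b = e 1 1 + u" unfolding 2(2) eq by (simp only: ac_simps)
        then show ?thesis by (simp add: S_def)
      qed
    }
  qed
  \<comment> \<open>\<open>L\<close> is only additive. Requiring it to vanish on all multiples of
    \<open>p\<close> gives an ideal inside its kernel.\<close>
  let ?X = "{p \<in> carrier (mpoly_ring verts). \<forall>r\<in>carrier (mpoly_ring verts). L (r * p) = 0}"
  have "ideal ?X (mpoly_ring verts)"
  proof (rule ideal_mpoly_ringI)
    fix r p :: "(vertex, 'k) mpoly" assume r: "r \<in> carrier (mpoly_ring verts)" and p: "p \<in> ?X"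
    have "L (q * (r * p)) = 0" if "q \<in> carrier (mpoly_ring verts)" for q
    proof -
      have "L ((q * r) * p) = 0" using p mpoly_closed(4)[OF that r] by blast
      then show ?thesis by (simp add: mult.assoc)
    qed
    then show "r * p \<in> ?X" using r p by (simp add: mpoly_closed)
  next
    show "0 \<in> ?X" by (simp add: mpoly_closed L_def)
  qed (auto simp: mpoly_closed distrib_left L_add)
  moreover have "Var (1, 1) * Var (a, b) - Var (1, b) * Var (a, 1) \<in> ?X" if ab: "(1, a, 1, b) \<in> C" for a b
  proof -
    let ?f = "Var (1, 1) * Var (a, b) - Var (1, b) * Var (a, 1) :: (vertex, 'k) mpoly"
    have vert: "(a, b) \<in> verts" using ab by (auto simp: verts_iff)
    have "L (r * ?f) = 0" for r
    proof -
      have "L (Poly_Mapping.single t c * ?f) = 0" for t c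
      proof -
        have "Poly_Mapping.single t c * ?f
            = Poly_Mapping.single (t + e 1 1 + e a b) c - Poly_Mapping.single (t + e 1 b + e a 1) c"
          by (simp add: Var_def e_def mult_single right_diff_distrib add.assoc)
        then show ?thesis using S[OF ab, of t] by (simp only: L_diff L_single) simp
      qed
      then have "(\<Sum>t\<in>Poly_Mapping.keys r. L (Poly_Mapping.single t (Poly_Mapping.lookup r t) * ?f)) = 0"
        by simp
      also have "(\<Sum>t\<in>Poly_Mapping.keys r. L (Poly_Mapping.single t (Poly_Mapping.lookup r t) * ?f))
          = L ((\<Sum>t\<in>Poly_Mapping.keys r. Poly_Mapping.single t (Poly_Mapping.lookup r t)) * ?f)"
        by (simp only: L_sum sum_distrib_right)
      finally show ?thesis by (simp only: poly_mapping_sum_single)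
    qed
    moreover have "?f \<in> carrier (mpoly_ring verts)"
      by (intro mpoly_closed(4,6) Var_carrier[OF vert])
    ultimately show ?thesis by simp
  qed
  ultimately have sub: "minor_ideal C \<subseteq> ?X" by (rule minor_ideal_subset)
  let ?p = "Var (1, 1) * (Poly_Mapping.single u 1 - Poly_Mapping.single v 1) :: (vertex, 'k) mpoly"
  assume "?p \<in> minor_ideal C"
  then have "L (1 * ?p) = 0" using sub mpoly_closed(2) by blast
  moreover have "?p = Poly_Mapping.single (e 1 1 + u) 1 - Poly_Mapping.single (e 1 1 + v) 1"
    by (simp add: Var_def e_def right_diff_distrib mult_single)
  moreover have "e 1 1 + v \<notin> S"
  proof
    assume "e 1 1 + v \<in> S"
    then obtain a b s where ab: "(1, a, 1, b) \<in> C" "e 1 1 + v = e a 1 + e 1 b + s"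
      using \<open>u \<noteq> v\<close> unfolding S_def by auto
    have "(a, 1) \<in> Poly_Mapping.keys (e 1 1 + v)" unfolding ab(2) by (simp add: keys_add_nat ke)
    then show False using v[of "(a, 1)"] corner_gt[OF ab(1)] by (auto simp: keys_add_nat ke)
  qed
  ultimately show False by (simp add: L_diff L_single) (simp add: S_def)
qed

lemma horizontal_interval_eq:
  assumes "H \<in> max_horizontal_intervals C"
  shows "H = {x \<in> verts. fst x = row_of H}" "\<And>x. x \<in> H \<Longrightarrow> fst x = row_of H"
proof -
  obtain a where a: "H = {x \<in> verts. fst x = a}" using assms by (auto simp: max_horizontal)
  have "horizontal_interval C H" using assms by (simp add: max_horizontal_intervals_def)
  then have row: "fst x = row_of H" if "x \<in> H" for x using row_of_eq[of C H x] that by simp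
  moreover have "H \<noteq> {}" using \<open>horizontal_interval C H\<close> by (simp add: horizontal_interval_def)
  ultimately have "row_of H = a" using a by auto
  then show "H = {x \<in> verts. fst x = row_of H}" "\<And>x. x \<in> H \<Longrightarrow> fst x = row_of H" using a by auto
qed

lemma vertical_interval_eq:
  assumes "V \<in> max_vertical_intervals C"
  shows "V = {x \<in> verts. snd x = col_of V}" "\<And>x. x \<in> V \<Longrightarrow> snd x = col_of V"
proof -
  obtain b where b: "V = {x \<in> verts. snd x = b}" using assms by (auto simp: max_vertical)
  have "vertical_interval C V" using assms by (simp add: max_vertical_intervals_def)
  then have col: "snd x = col_of V" if "x \<in> V" for x using col_of_eq[of C V x] that by simp
  moreover have "V \<noteq> {}" using \<open>vertical_interval C V\<close> by (simp add: vertical_interval_def)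
  ultimately have "col_of V = b" using b by auto
  then show "V = {x \<in> verts. snd x = col_of V}" "\<And>x. x \<in> V \<Longrightarrow> snd x = col_of V" using b by auto
qed

text \<open>Each variable of the monomial takes one factor x_11 and splits into a row part and a
  column part, so the pairing of rows with columns is forgotten.\<close>

lemma corner_power_times_monomial:
  assumes "finite A" and "\<And>i. i \<in> A \<Longrightarrow> (f i, g i) \<in> verts"
  shows "Var (1, 1) ^ card A * (\<Prod>i\<in>A. Var (f i, g i)) - (\<Prod>i\<in>A. Var (f i, 1)) * (\<Prod>i\<in>A. Var (1, g i))
    \<in> (minor_ideal C :: (vertex, 'k::field) mpoly set)"
proof -
  have "(\<Prod>i\<in>A. Var (1, 1) * Var (f i, g i)) - (\<Prod>i\<in>A. Var (f i, 1) * Var (1, g i))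
      \<in> (minor_ideal C :: (vertex, 'k) mpoly set)"
  proof (rule ideal_prod_cong[OF ideal_minor_ideal])
    fix i assume "i \<in> A"
    note v = assms(2)[OF this]
    show "Var (1, 1) * Var (f i, g i) \<in> carrier (mpoly_ring verts :: (vertex, 'k) mpoly ring)"
      and "Var (f i, 1) * Var (1, g i) \<in> carrier (mpoly_ring verts :: (vertex, 'k) mpoly ring)"
      by (intro mpoly_closed(4) Var_carrier[OF v])+
    show "Var (1, 1) * Var (f i, g i) - Var (f i, 1) * Var (1, g i) \<in> (minor_ideal C :: (vertex, 'k) mpoly set)"
      by (rule corner_relation[OF v])
  qed
  then show ?thesis by (simp add: prod.distrib)
qed

text \<open>The cycle is a bare list that may start with either kind of interval. Its places are
  therefore split into \<open>A\<close> (rows) and \<open>B\<close> (columns), and the cyclic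
  successor \<open>s\<close> maps each bijectively onto the other; the edges leaving
  \<open>A\<close> give \<open>u\<close>, those leaving \<open>B\<close> give
  \<open>v\<close>.\<close>

lemma not_radical_if_cycle:
  assumes H1: "H1 \<in> max_horizontal_intervals C" "(1, 1) \<in> H1"
    and V1: "V1 \<in> max_vertical_intervals C" "(1, 1) \<in> V1"
    and cyc: "is_cycle (delete_verts (interval_graph C) {Inr V1, Inl H1}) c"
  shows "\<not> radical_ideal (minor_ring C) (minor_ideal C :: (vertex, 'k::field) mpoly set)"
proof
  define N where "N = length c"
  define s where "s i = (i + 1) mod N" for i
  have N: "3 \<le> N" and dist: "distinct c" and deleted: "set c \<inter> {Inr V1, Inl H1} = {}"
    and edges: "\<And>i. i < N \<Longrightarrow> {c ! i, c ! s i} \<in> snd (interval_graph C)"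
    using cyc unfolding is_cycle_delete_verts by (auto simp: is_cycle_def N_def s_def)
  have s_eq: "s i = (if Suc i = N then 0 else Suc i)" if "i < N" for i
    using that by (auto simp: s_def)
  have s_less: "s i < N" if "i < N" for i using that N by (auto simp: s_eq)
  have s_inj: "inj_on s {..<N}" using N by (auto simp: inj_on_def s_eq split: if_splits)
  then have s_surj: "s ` {..<N} = {..<N}"
    by (intro card_subset_eq) (auto simp: card_image s_less)
  define A B where "A = {i. i < N \<and> isl (c ! i)}" and "B = {i. i < N \<and> \<not> isl (c ! i)}"
  define f g where "f i = row_of (projl (c ! i))" and "g i = col_of (projr (c ! i))" for i
  have sides: "isl (c ! s i) \<longleftrightarrow> \<not> isl (c ! i)" if "i < N" for i
    using edges[OF that] by (auto simp: interval_graph_def doubleton_eq_iff)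
  have max: "c ! i = Inl (projl (c ! i)) \<and> projl (c ! i) \<in> max_horizontal_intervals C \<and>
      (f i, g (s i)) \<in> verts" if "i \<in> A" for i
  proof -
    have i: "i < N" "isl (c ! i)" using that by (auto simp: A_def)
    then obtain H V where HV: "c ! i = Inl H" "c ! s i = Inr V" "H \<in> max_horizontal_intervals C"
      "V \<in> max_vertical_intervals C" "H \<inter> V \<noteq> {}"
      using edges[OF i(1)] by (auto simp: interval_graph_def doubleton_eq_iff)
    obtain x where x: "x \<in> H" "x \<in> V" using HV(5) by blast
    then have "x = (f i, g (s i))"
      using horizontal_interval_eq(2)[OF HV(3) x(1)] vertical_interval_eq(2)[OF HV(4) x(2)] HV(1,2)
      by (simp add: f_def g_def prod_eq_iff)
    moreover have "x \<in> verts" using x horizontal_interval_eq(1)[OF HV(3)] by blast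
    ultimately show ?thesis using HV by simp
  qed
  have max': "c ! i = Inr (projr (c ! i)) \<and> projr (c ! i) \<in> max_vertical_intervals C \<and>
      (f (s i), g i) \<in> verts" if "i \<in> B" for i
  proof -
    have i: "i < N" "\<not> isl (c ! i)" using that by (auto simp: B_def)
    then obtain H V where HV: "c ! s i = Inl H" "c ! i = Inr V" "H \<in> max_horizontal_intervals C"
      "V \<in> max_vertical_intervals C" "H \<inter> V \<noteq> {}"
      using edges[OF i(1)] by (auto simp: interval_graph_def doubleton_eq_iff)
    obtain x where x: "x \<in> H" "x \<in> V" using HV(5) by blast
    then have "x = (f (s i), g i)"
      using horizontal_interval_eq(2)[OF HV(3) x(1)] vertical_interval_eq(2)[OF HV(4) x(2)] HV(1,2)
      by (simp add: f_def g_def prod_eq_iff)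
    moreover have "x \<in> verts" using x horizontal_interval_eq(1)[OF HV(3)] by blast
    ultimately show ?thesis using HV by simp
  qed
  have f_inj: "i = j" if "i \<in> A" "j \<in> A" "f i = f j" for i j
  proof -
    have "c ! i = c ! j"
      using max[OF that(1)] max[OF that(2)] that(3) horizontal_interval_eq(1) unfolding f_def by metis
    then show ?thesis using that dist by (simp add: A_def N_def nth_eq_iff_index_eq)
  qed
  have g_inj: "i = j" if "i \<in> B" "j \<in> B" "g i = g j" for i j
  proof -
    have "c ! i = c ! j"
      using max'[OF that(1)] max'[OF that(2)] that(3) vertical_interval_eq(1) unfolding g_def by metis
    then show ?thesis using that dist by (simp add: B_def N_def nth_eq_iff_index_eq)
  qed
  have f_ne: "f i \<noteq> 1" if i: "i \<in> A" for i
  proof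
    assume "f i = 1"
    then have "projl (c ! i) = H1"
      using max[OF i] horizontal_interval_eq[OF H1(1)] H1(2) horizontal_interval_eq(1)[of "projl (c ! i)"]
      unfolding f_def by (metis fst_conv)
    then have "Inl H1 \<in> set c" using max[OF i] i nth_mem[of i c] by (auto simp: A_def N_def)
    then show False using deleted by blast
  qed
  have g_ne: "g i \<noteq> 1" if i: "i \<in> B" for i
  proof
    assume "g i = 1"
    then have "projr (c ! i) = V1"
      using max'[OF i] vertical_interval_eq[OF V1(1)] V1(2) vertical_interval_eq(1)[of "projr (c ! i)"]
      unfolding g_def by (metis snd_conv)
    then have "Inr V1 \<in> set c" using max'[OF i] i nth_mem[of i c] by (auto simp: B_def N_def)
    then show False using deleted by blast
  qed
  have fin: "finite A" "finite B" by (auto simp: A_def B_def)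
  have bij: "bij_betw s A B" "bij_betw s B A"
  proof -
    have pre: "\<exists>i<N. j = s i" if "j < N" for j using s_surj that by (metis imageE lessThan_iff)
    have "s ` A \<subseteq> B" "s ` B \<subseteq> A" using sides s_less by (auto simp: A_def B_def)
    moreover have "j \<in> s ` A" if "j \<in> B" for j
      using that pre[of j] sides by (auto simp: A_def B_def)
    moreover have "j \<in> s ` B" if "j \<in> A" for j
      using that pre[of j] sides by (auto simp: A_def B_def)
    ultimately have "s ` A = B" "s ` B = A" by blast+
    then show "bij_betw s A B" "bij_betw s B A"
      using s_inj by (auto simp: bij_betw_def A_def B_def intro: inj_on_subset)
  qed
  define u v where "u = (\<Sum>i\<in>A. Poly_Mapping.single (f i, g (s i)) (1::nat))"
    and "v = (\<Sum>i\<in>B. Poly_Mapping.single (f (s i), g i) (1::nat))"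
  have ku: "Poly_Mapping.keys u = (\<lambda>i. (f i, g (s i))) ` A"
    using fin unfolding u_def by (induction A rule: finite_induct) (auto simp: keys_add_nat)
  have kv: "Poly_Mapping.keys v = (\<lambda>i. (f (s i), g i)) ` B"
    using fin(2) unfolding v_def by (induction B rule: finite_induct) (auto simp: keys_add_nat)
  have sA: "s i \<in> B" if "i \<in> A" for i using bij(1) that by (auto simp: bij_betw_def)
  have sB: "s i \<in> A" if "i \<in> B" for i using bij(2) that by (auto simp: bij_betw_def)
  have "0 \<in> A \<or> s 0 \<in> A"
    using N sides[of 0] s_less[of 0] by (auto simp: A_def)
  then obtain i0 where i0: "i0 \<in> A" by blast
  \<comment> \<open>If the edge leaving \<open>i0\<close> had the same vertex as an edge leaving
    some \<open>j\<close> in \<open>B\<close>, then \<open>j\<close> would be \<open>s i0\<close>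
    and \<open>s j\<close> would be \<open>i0\<close>, which is impossible in a cycle of length at
    least 3.\<close>
  have "u \<noteq> v"
  proof
    assume "u = v"
    then have "(f i0, g (s i0)) \<in> Poly_Mapping.keys v" using ku i0 by blast
    then obtain j where j: "j \<in> B" "f (s j) = f i0" "g j = g (s i0)" by (auto simp: kv)
    then have "j = s i0" "s j = i0" using g_inj sA sB f_inj i0 by metis+
    then have "s (s i0) = i0" by simp
    moreover have "i0 < N" using i0 by (simp add: A_def)
    ultimately show False using N s_less[of i0] by (auto simp: s_eq split: if_splits)
  qed
  define p where "p = (Poly_Mapping.single u 1 - Poly_Mapping.single v 1 :: (vertex, 'k) mpoly)"
  note D = ideal_mpoly_ringD[OF ideal_minor_ideal[where 'k = 'k]]
  have z: "Var (1, 1) \<in> carrier (mpoly_ring verts :: (vertex, 'k) mpoly ring)"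
    using max[OF i0] Var_carrier(4) by blast
  have p: "p \<in> carrier (mpoly_ring verts)"
    unfolding p_def using max max' by (intro mpoly_closed) (auto simp: ku kv)
  have card: "card B = card A" using bij_betw_same_card[OF bij(1)] by simp
  have uA: "(\<Prod>i\<in>A. Var (f i, g (s i))) = (Poly_Mapping.single u 1 :: (vertex, 'k) mpoly)"
    and vB: "(\<Prod>i\<in>B. Var (f (s i), g i)) = (Poly_Mapping.single v 1 :: (vertex, 'k) mpoly)"
    by (simp_all add: prod_Var u_def v_def)
  have reindex: "(\<Prod>i\<in>A. Var (1, g (s i))) = (\<Prod>i\<in>B. Var (1, g i) :: (vertex, 'k) mpoly)"
    "(\<Prod>i\<in>B. Var (f (s i), 1)) = (\<Prod>i\<in>A. Var (f i, 1) :: (vertex, 'k) mpoly)"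
    by (rule prod.reindex_bij_betw[OF bij(1)], rule prod.reindex_bij_betw[OF bij(2)])
  \<comment> \<open>The common value modulo I(C) of \<open>u\<close> and \<open>v\<close> times the
    power of x_11; it depends only on the rows and columns of the cycle.\<close>
  let ?w = "(\<Prod>i\<in>A. Var (f i, 1)) * (\<Prod>i\<in>B. Var (1, g i)) :: (vertex, 'k) mpoly"
  have "Var (1, 1) ^ card A * Poly_Mapping.single u 1 - ?w \<in> minor_ideal C"
    using corner_power_times_monomial[OF fin(1), of f "\<lambda>i. g (s i)", where 'k = 'k] max
    unfolding uA reindex(1) by blast
  moreover have "Var (1, 1) ^ card A * Poly_Mapping.single v 1 - ?w \<in> minor_ideal C"
    using corner_power_times_monomial[OF fin(2), of "\<lambda>i. f (s i)" g, where 'k = 'k] max'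
    unfolding vB reindex(2) card by blast
  ultimately have "(Var (1, 1) ^ card A * Poly_Mapping.single u 1 - ?w)
      - (Var (1, 1) ^ card A * Poly_Mapping.single v 1 - ?w) \<in> minor_ideal C"
    by (rule D(6))
  then have mem: "Var (1, 1) ^ card A * p \<in> minor_ideal C" by (simp add: p_def right_diff_distrib)
  obtain r where r: "card A = Suc r" using i0 fin(1) by (cases "card A") auto
  interpret cring "mpoly_ring verts :: (vertex, 'k) mpoly ring" by (rule cring_mpoly_ring)
  \<comment> \<open>Multiplying by \<open>p ^ r\<close> completes x_11^(r+1) p to the power (x_11
    p)^(r+1).\<close>
  have "p ^ r \<in> carrier (mpoly_ring verts)" using nat_pow_closed[OF p, of r] by simp
  from D(4)[OF this mem] have "(Var (1, 1) * p) ^ card A \<in> minor_ideal C"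
    by (simp add: r power_mult_distrib mult_ac)
  moreover have "Var (1, 1) * p \<in> carrier (mpoly_ring verts)" using z p by (rule mpoly_closed)
  moreover have "0 < card A" using r by simp
  moreover assume "radical_ideal (minor_ring C) (minor_ideal C :: (vertex, 'k) mpoly set)"
  ultimately have "Var (1, 1) * p \<in> minor_ideal C"
    unfolding radical_ideal_def radical_of_def minor_ring_eq by auto
  moreover have "fst x \<noteq> 1 \<and> snd x \<noteq> 1" if "x \<in> Poly_Mapping.keys u" for x
    using that f_ne g_ne sA by (auto simp: ku)
  moreover have "fst x \<noteq> 1 \<and> snd x \<noteq> 1" if "x \<in> Poly_Mapping.keys v" for x
    using that f_ne g_ne sB by (auto simp: kv)
  ultimately show False
    unfolding p_def using \<open>u \<noteq> v\<close> corner_times_binomial_notin by blast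
qed

end

section \<open>Admissible ideals and the primary decomposition\<close>

lemma set_add_mpoly_ring: "A <+>\<^bsub>mpoly_ring V\<^esub> B = {p + q | p q. p \<in> A \<and> q \<in> B}"
  by (auto simp: set_add_def')

lemma Idl_empty: "Idl\<^bsub>mpoly_ring V\<^esub> {} = ({0} :: ('x, 'k::field) mpoly set)"
proof -
  have "var_ideal V {} = ({0} :: ('x, 'k) mpoly set)"
    by (auto simp: var_ideal_def mpoly_closed)
  then show ?thesis using Idl_Var[of "{}" V, where 'k = 'k] by simp
qed

lemma cycle_polys_empty: "cycle_polys {} = {}"
proof -
  have "f \<notin> cycle_polys {}" for f :: "(vertex, 'a) mpoly"
  proof
    assume "f \<in> cycle_polys {}"
    then obtain r :: nat and a b where "2 \<le> r" "\<And>k. k < r \<Longrightarrow> (a k, b k) \<in> verts_of {}"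
      by (elim cycle_polysE) blast
    from this(1) this(2)[of 0] show False by (simp add: verts_of_def)
  qed
  then show ?thesis by blast
qed

context corner_minors
begin

lemma admissible_ideal_eq:
  assumes "W \<subseteq> verts"
  shows "admissible_ideal C W =
    {p + q | p q. p \<in> var_ideal verts W \<and> q \<in> cycle_ideal C {d \<in> C. minor_verts d \<inter> W = {}}}"
  by (simp add: admissible_ideal_def minor_ring_eq set_add_mpoly_ring Idl_Var[OF assms])

lemma cycle_ideal_toric: "cycle_ideal C C = (toric_ideal verts :: (vertex, 'k::field) mpoly set)"
proof
  interpret cring "mpoly_ring verts :: (vertex, 'k) mpoly ring" by (rule cring_mpoly_ring)
  show "cycle_ideal C C \<subseteq> (toric_ideal verts :: (vertex, 'k) mpoly set)"
    unfolding cycle_ideal_def minor_ring_eq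
    using primeideal_toric_ideal primeideal.axioms(1) cycle_polys_toric by (intro genideal_minimal) blast+
  have sub: "cycle_polys C \<subseteq> carrier (mpoly_ring verts :: (vertex, 'k) mpoly ring)"
    by (rule cycle_polys_carrier) simp
  show "(toric_ideal verts :: (vertex, 'k) mpoly set) \<subseteq> cycle_ideal C C"
    unfolding cycle_ideal_def minor_ring_eq
    using alternating_poly_mem_cycle_polys genideal_self[OF sub]
    by (intro toric_ideal_subset genideal_ideal[OF sub]) blast
qed

lemma admissible_ideal_empty: "admissible_ideal C {} = (toric_ideal verts :: (vertex, 'k::field) mpoly set)"
proof -
  have "var_ideal verts {} = ({0} :: (vertex, 'k) mpoly set)"
    using Idl_Var[of "{}" verts, where 'k = 'k] Idl_empty[of verts, where 'k = 'k] by simp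
  then show ?thesis by (simp add: admissible_ideal_eq cycle_ideal_toric)
qed

text \<open>Every corner minor has (1, 1) among its vertices, so none is disjoint from
  \<open>W\<close> and the cycle part of P_W is zero.\<close>

lemma admissible_ideal_corner:
  assumes "W \<subseteq> verts" "(1, 1) \<in> W"
  shows "admissible_ideal C W = (var_ideal verts W :: (vertex, 'k::field) mpoly set)"
proof -
  have "(1, 1) \<in> minor_verts d" if "d \<in> C" for d by (rule cornerE[OF that]) simp
  then have none: "{d \<in> C. minor_verts d \<inter> W = {}} = {}" using assms(2) by blast
  have "cycle_ideal C {d \<in> C. minor_verts d \<inter> W = {}} = ({0} :: (vertex, 'k) mpoly set)"
    by (simp only: none cycle_ideal_def cycle_polys_empty minor_ring_eq Idl_empty)
  then show ?thesis by (simp add: admissible_ideal_eq[OF assms(1)])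
qed

text \<open>The cycle binomials have degree at least two, so \<open>P\<^sub>W\<close> contains no variables outside \<open>W\<close>.\<close>

lemma Var_mem_admissible_ideal:
  assumes W: "W \<subseteq> verts" and x: "x \<in> verts"
  shows "Var x \<in> (admissible_ideal C W :: (vertex, 'k::field) mpoly set) \<longleftrightarrow> x \<in> W"
proof -
  interpret cring "mpoly_ring verts :: (vertex, 'k) mpoly ring" by (rule cring_mpoly_ring)
  let ?D = "{d \<in> C. minor_verts d \<inter> W = {}}"
  let ?X = "{q \<in> carrier (mpoly_ring verts :: (vertex, 'k) mpoly ring). \<forall>t\<in>Poly_Mapping.keys q. 2 \<le> total_degree t}"
  have X: "ideal ?X (mpoly_ring verts)"
  proof (rule ideal_mpoly_ringI)
    fix p q :: "(vertex, 'k) mpoly" assume "p \<in> ?X" "q \<in> ?X"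
    then show "p + q \<in> ?X" using Poly_Mapping.keys_add[of p q] by (auto simp: mpoly_closed dest!: subsetD)
  next
    fix r p :: "(vertex, 'k) mpoly" assume r: "r \<in> carrier (mpoly_ring verts)" and p: "p \<in> ?X"
    have "2 \<le> total_degree t" if t: "t \<in> Poly_Mapping.keys (r * p)" for t
    proof -
      obtain s u where su: "t = s + u" "u \<in> Poly_Mapping.keys p"
        using subsetD[OF keys_mult t] by blast
      then show ?thesis using p by (auto simp: total_degree_add trans_le_add2)
    qed
    then show "r * p \<in> ?X" using r p by (simp add: mpoly_closed)
  qed (auto simp: mpoly_closed)
  have V: "verts_of ?D \<subseteq> verts" by (auto simp: verts_of_def)
  have "cycle_polys ?D \<subseteq> ?X" using cycle_polys_carrier[OF V] cycle_polys_keys by blast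
  then have sub: "cycle_ideal C ?D \<subseteq> ?X"
    unfolding cycle_ideal_def minor_ring_eq by (rule genideal_minimal[OF X])
  have zero: "0 \<in> (cycle_ideal C ?D :: (vertex, 'k) mpoly set)"
    unfolding cycle_ideal_def minor_ring_eq
    by (rule ideal_mpoly_ringD(2)[OF genideal_ideal[OF cycle_polys_carrier[OF V]]])
  show ?thesis
  proof
    assume "x \<in> W"
    then have "Var x \<in> (var_ideal verts W :: (vertex, 'k) mpoly set)"
      using x by (auto simp: var_ideal_def mpoly_closed) (simp add: Var_def)
    then have "Var x + 0 \<in> (admissible_ideal C W :: (vertex, 'k) mpoly set)"
      using zero unfolding admissible_ideal_eq[OF W] by blast
    then show "Var x \<in> (admissible_ideal C W :: (vertex, 'k) mpoly set)" by simp
  next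
    assume "Var x \<in> (admissible_ideal C W :: (vertex, 'k) mpoly set)"
    then obtain p q :: "(vertex, 'k) mpoly" where
      pq: "Var x = p + q" "p \<in> var_ideal verts W" "q \<in> cycle_ideal C ?D"
      unfolding admissible_ideal_eq[OF W] by blast
    let ?t = "Poly_Mapping.single x (1::nat)"
    have "?t \<notin> Poly_Mapping.keys q" using pq(3) sub by fastforce
    moreover have "?t \<in> Poly_Mapping.keys (p + q)" by (simp add: pq(1)[symmetric] Var_def)
    ultimately have "?t \<in> Poly_Mapping.keys p" using Poly_Mapping.keys_add[of p q] by blast
    then show "x \<in> W" using pq(2) by (auto simp: var_ideal_def dest!: bspec)
  qed
qed

lemma inj_on_admissible_ideal:
  "inj_on (admissible_ideal C :: _ \<Rightarrow> (vertex, 'k::field) mpoly set) {W. admissible C W}"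
proof (rule inj_onI)
  fix W W' assume W: "W \<in> {W. admissible C W}" "W' \<in> {W. admissible C W}"
    and eq: "admissible_ideal C W = (admissible_ideal C W' :: (vertex, 'k) mpoly set)"
  have sub: "W \<subseteq> verts" "W' \<subseteq> verts" using W by (auto simp: admissible_def)
  have "x \<in> W \<longleftrightarrow> x \<in> W'" if "x \<in> verts" for x
    using Var_mem_admissible_ideal[OF sub(1) that, where 'k = 'k]
      Var_mem_admissible_ideal[OF sub(2) that, where 'k = 'k] eq by simp
  then show "W = W'" using sub by blast
qed

text \<open>Each of the four edges of the minor contains (a, 1) or (1, b), and either of these forms
  an edge with (1, 1). Such \<open>W\<close> are the vertex covers of the graph with edges between
  (a, 1) and (1, b). This fits the fact that modulo x_11 the minors become the monomials x_a1 x_1b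
  up to sign, that is, the generators of an edge ideal.\<close>

lemma admissible_corner_iff:
  assumes "W \<subseteq> verts" "(1, 1) \<in> W"
  shows "admissible C W \<longleftrightarrow> (\<forall>a b. (1, a, 1, b) \<in> C \<longrightarrow> (a, 1) \<in> W \<or> (1, b) \<in> W)"
proof
  assume adm: "admissible C W"
  show "\<forall>a b. (1, a, 1, b) \<in> C \<longrightarrow> (a, 1) \<in> W \<or> (1, b) \<in> W"
  proof (intro allI impI)
    fix a b assume d: "(1, a, 1, b) \<in> C"
    then have "W \<inter> minor_verts (1, a, 1, b) \<noteq> {}" using assms(2) by auto
    then obtain e where "e \<in> minor_edges (1, a, 1, b)" "e \<subseteq> W" using adm d by (auto simp: admissible_def)
    then show "(a, 1) \<in> W \<or> (1, b) \<in> W" by (auto simp: minor_edges_def)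
  qed
next
  assume cover: "\<forall>a b. (1, a, 1, b) \<in> C \<longrightarrow> (a, 1) \<in> W \<or> (1, b) \<in> W"
  have "\<exists>e\<in>minor_edges d. e \<subseteq> W \<inter> minor_verts d" if "d \<in> C" for d
  proof -
    obtain a b where d: "d = (1, a, 1, b)" using \<open>d \<in> C\<close> by (rule cornerE)
    then have "(a, 1) \<in> W \<or> (1, b) \<in> W" using cover that by blast
    then show ?thesis using assms(2) by (auto simp: d minor_edges_def)
  qed
  then show "admissible C W" using assms(1) by (auto simp: admissible_def)
qed

lemma minor_ideal_subset_toric: "minor_ideal C \<subseteq> (toric_ideal verts :: (vertex, 'k::field) mpoly set)"
proof (rule minor_ideal_subset)
  show "ideal (toric_ideal verts :: (vertex, 'k) mpoly set) (mpoly_ring verts)"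
    using primeideal_toric_ideal by (rule primeideal.axioms(1))
  fix a b assume ab: "(1, a, 1, b) \<in> C"
  have "(a, b) \<in> verts" using ab by (auto simp: verts_iff)
  then have "Var (1, 1) * Var (a, b) - Var (1, b) * Var (a, 1) \<in> carrier (mpoly_ring verts :: (vertex, 'k) mpoly ring)"
    by (intro mpoly_closed(4,6) Var_carrier)
  moreover have "push bidegree (Var (1, 1) * Var (a, b) - Var (1, b) * Var (a, 1) :: (vertex, 'k) mpoly) = 0"
    by (simp add: Var_def mult_single push_diff bidegree_add bidegree_single ac_simps)
  ultimately show "Var (1, 1) * Var (a, b) - Var (1, b) * Var (a, 1) \<in> (toric_ideal verts :: (vertex, 'k) mpoly set)"
    by (simp add: toric_ideal_def)
qed

lemma minor_ideal_subset_var_ideal: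
  assumes "admissible C W" "(1, 1) \<in> W"
  shows "minor_ideal C \<subseteq> (var_ideal verts W :: (vertex, 'k::field) mpoly set)"
proof (rule minor_ideal_subset[OF ideal_var_ideal])
  note D = ideal_mpoly_ringD[OF ideal_var_ideal[of verts W, where 'k = 'k]]
  have W: "W \<subseteq> verts" using assms(1) by (simp add: admissible_def)
  have mem: "Var x \<in> (var_ideal verts W :: (vertex, 'k) mpoly set)" if "x \<in> W" for x
    using that W by (auto simp: var_ideal_def intro!: mpoly_closed(7)) (simp add: Var_def)
  fix a b assume ab: "(1, a, 1, b) \<in> C"
  then have "(a, b) \<in> verts" by (auto simp: verts_iff)
  note car = Var_carrier[OF this, where 'k = 'k]
  have "Var (a, b) * Var (1, 1) \<in> (var_ideal verts W :: (vertex, 'k) mpoly set)"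
    using car(1) mem[OF assms(2)] by (rule D(4))
  moreover have "(a, 1) \<in> W \<or> (1, b) \<in> W" using assms W ab admissible_corner_iff by blast
  then have "Var (1, b) * Var (a, 1) \<in> (var_ideal verts W :: (vertex, 'k) mpoly set)"
    using D(4)[OF car(3) mem] D(4)[OF car(2) mem] by (metis mult.commute)
  ultimately show "Var (1, 1) * Var (a, b) - Var (1, b) * Var (a, 1) \<in> (var_ideal verts W :: (vertex, 'k) mpoly set)"
    using D(6) by (simp add: mult.commute)
qed

lemma mem_minor_ideal_if:
  assumes H1: "(1, 1) \<in> H1" and V1: "(1, 1) \<in> V1"
    and acyclic: "\<not> (\<exists>c. is_cycle (delete_verts (interval_graph C) {Inr V1, Inl H1}) c)"
    and "C \<noteq> {}" and p: "p \<in> toric_ideal verts"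
    and W: "\<And>W. admissible C W \<Longrightarrow> (1, 1) \<in> W \<Longrightarrow> p \<in> var_ideal verts W"
  shows "p \<in> (minor_ideal C :: (vertex, 'k::field) mpoly set)"
proof -
  note D = ideal_mpoly_ringD[OF ideal_minor_ideal[where 'k = 'k]]
  obtain d where "d \<in> C" using \<open>C \<noteq> {}\<close> by blast
  then obtain a0 b0 where "(1, a0, 1, b0) \<in> C" by (metis cornerE)
  then have corner: "(1, 1) \<in> verts" by (auto simp: verts_iff)
  have z: "Var (1, 1) \<in> carrier (mpoly_ring verts :: (vertex, 'k) mpoly ring)"
    using corner by (rule mpoly_closed(7))
  \<comment> \<open>This is the ideal (x_11) + I(C); membership of \<open>p\<close> is shown
    monomial by monomial.\<close>
  let ?N = "{p \<in> carrier (mpoly_ring verts). \<exists>q\<in>carrier (mpoly_ring verts).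
    p - Var (1, 1) * q \<in> (minor_ideal C :: (vertex, 'k) mpoly set)}"
  have N: "ideal ?N (mpoly_ring verts)"
  proof (rule ideal_mpoly_ringI)
    fix p p' assume "p \<in> ?N" "p' \<in> ?N"
    then obtain q q' where q: "p \<in> carrier (mpoly_ring verts)" "p' \<in> carrier (mpoly_ring verts)"
      "q \<in> carrier (mpoly_ring verts)" "q' \<in> carrier (mpoly_ring verts)"
      "p - Var (1, 1) * q \<in> minor_ideal C" "p' - Var (1, 1) * q' \<in> minor_ideal C" by blast
    then have "(p + p') - Var (1, 1) * (q + q') \<in> minor_ideal C"
      using D(3)[OF q(5,6)] by (simp add: algebra_simps)
    then show "p + p' \<in> ?N" using q mpoly_closed(3) by blast
  next
    fix r p :: "(vertex, 'k) mpoly" assume r: "r \<in> carrier (mpoly_ring verts)" and "p \<in> ?N"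
    then obtain q where q: "p \<in> carrier (mpoly_ring verts)" "q \<in> carrier (mpoly_ring verts)"
      "p - Var (1, 1) * q \<in> minor_ideal C" by blast
    then have "r * p - Var (1, 1) * (r * q) \<in> minor_ideal C"
      using D(4)[OF r q(3)] by (simp add: algebra_simps)
    then show "r * p \<in> ?N" using r q mpoly_closed(4) by blast
  next
    have "0 - Var (1, 1) * 0 \<in> (minor_ideal C :: (vertex, 'k) mpoly set)" using D(2) by simp
    then show "0 \<in> ?N" using mpoly_closed(1) by blast
  qed auto
  have pc: "p \<in> carrier (mpoly_ring verts)" using p by (simp add: toric_ideal_def)
  \<comment> \<open>A monomial divisible by no \<open>x\<^sub>1\<^sub>b x\<^sub>a\<^sub>1\<close> and not by \<open>x\<^sub>1\<^sub>1\<close> would avoid the admissible set of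
    all variables not dividing it.\<close>
  have "Poly_Mapping.single t (Poly_Mapping.lookup p t) \<in> ?N" if t: "t \<in> Poly_Mapping.keys p" for t
  proof -
    let ?c = "Poly_Mapping.lookup p t"
    have tV: "Poly_Mapping.keys t \<subseteq> verts" using pc t by (auto simp: carrier_mpoly_ring_iff)
    have zero: "0 \<in> (minor_ideal C :: (vertex, 'k) mpoly set)" by (rule D(2))
    show ?thesis
    proof (cases "(1, 1) \<in> Poly_Mapping.keys t")
      case True
      then obtain s where s: "t = Poly_Mapping.single (1, 1) 1 + s" by (rule monomial_split1)
      have "Poly_Mapping.single s ?c \<in> carrier (mpoly_ring verts)"
        using tV by (intro mpoly_closed) (simp add: s keys_add_nat)
      moreover have "Poly_Mapping.single t ?c - Var (1, 1) * Poly_Mapping.single s ?c = 0"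
        by (simp add: s Var_def mult_single)
      moreover have "Poly_Mapping.single t ?c \<in> carrier (mpoly_ring verts)"
        using tV by (rule mpoly_closed)
      ultimately show ?thesis using zero by (metis (mono_tags, lifting) mem_Collect_eq)
    next
      case False
      let ?W = "{x \<in> verts. x \<notin> Poly_Mapping.keys t}"
      have W11: "(1, 1) \<in> ?W" using corner False by blast
      have "p \<notin> var_ideal verts ?W" using t by (auto simp: var_ideal_def)
      then have "\<not> admissible C ?W" using W W11 by blast
      then obtain a b where ab: "(1, a, 1, b) \<in> C" "(a, 1) \<notin> ?W" "(1, b) \<notin> ?W"
        using admissible_corner_iff[OF _ W11] by blast
      have vert: "(a, b) \<in> verts" using ab(1) by (auto simp: verts_iff)
      then have keys: "(a, 1) \<in> Poly_Mapping.keys t" "(1, b) \<in> Poly_Mapping.keys t"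
        using ab verts_corner[OF vert] by auto
      obtain s' where s': "t = Poly_Mapping.single (a, 1) 1 + s'" using keys(1) by (rule monomial_split1)
      have "(1, b) \<in> Poly_Mapping.keys s'"
        using keys(2) corner_gt[OF ab(1)] by (auto simp: s' keys_add_nat)
      then obtain s where s: "s' = Poly_Mapping.single (1, b) 1 + s" by (rule monomial_split1)
      have sc: "Poly_Mapping.single s ?c \<in> carrier (mpoly_ring verts)"
        using tV by (intro mpoly_closed) (simp add: s s' keys_add_nat)
      have "- (Poly_Mapping.single s ?c * (Var (1, 1) * Var (a, b) - Var (a, 1) * Var (1, b))) \<in> minor_ideal C"
        by (rule D(5)[OF D(4)[OF sc corner_relation[OF vert]]])
      moreover have "Poly_Mapping.single t ?c = Var (a, 1) * Var (1, b) * Poly_Mapping.single s ?c"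
        by (simp add: s s' Var_def mult_single add.assoc)
      ultimately have "Poly_Mapping.single t ?c - Var (1, 1) * (Var (a, b) * Poly_Mapping.single s ?c)
          \<in> minor_ideal C"
        by (simp add: algebra_simps)
      moreover have "Var (a, b) * Poly_Mapping.single s ?c \<in> carrier (mpoly_ring verts)"
        by (intro mpoly_closed(4) Var_carrier(1)[OF vert] sc)
      moreover have "Poly_Mapping.single t ?c \<in> carrier (mpoly_ring verts)"
        using tV by (rule mpoly_closed)
      ultimately show ?thesis by blast
    qed
  qed
  then have "(\<Sum>t\<in>Poly_Mapping.keys p. Poly_Mapping.single t (Poly_Mapping.lookup p t)) \<in> ?N"
    by (rule ideal_sum_closed[OF N])
  then have "p \<in> ?N" by (simp only: poly_mapping_sum_single)
  then obtain q where q: "q \<in> carrier (mpoly_ring verts)" "p - Var (1, 1) * q \<in> minor_ideal C" by blast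
  interpret T: primeideal "toric_ideal verts :: (vertex, 'k) mpoly set" "mpoly_ring verts"
    by (rule primeideal_toric_ideal)
  \<comment> \<open>The modular law on elements: since I(C) is contained in J, also x_11 q lies in
    J. As J is prime and does not contain x_11, it contains \<open>q\<close>, and then x_11 q lies
    in I(C).\<close>
  have "p - (p - Var (1, 1) * q) \<in> toric_ideal verts"
    by (rule ideal_mpoly_ringD(6)[OF T.is_ideal p subsetD[OF minor_ideal_subset_toric q(2)]])
  then have "Var (1, 1) * q \<in> toric_ideal verts" by simp
  moreover have "Var (1, 1) \<notin> (toric_ideal verts :: (vertex, 'k) mpoly set)"
  proof
    let ?t = "Poly_Mapping.single (1, 1) (1::nat) :: vertex \<Rightarrow>\<^sub>0 nat"
    assume "Var (1, 1) \<in> (toric_ideal verts :: (vertex, 'k) mpoly set)"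
    then have "Poly_Mapping.single (bidegree ?t) (1::'k) = 0"
      unfolding toric_ideal_def Var_def by (simp only: mem_Collect_eq push_single)
    then have "Poly_Mapping.lookup (Poly_Mapping.single (bidegree ?t) (1::'k)) (bidegree ?t) = 0"
      by (simp only: lookup_zero)
    then show False by (simp only: lookup_single_eq one_neq_zero)
  qed
  ultimately have "q \<in> toric_ideal verts" using T.I_prime[OF z q(1)] by simp
  then have "Var (1, 1) * q \<in> minor_ideal C"
    by (rule corner_times_toric[OF H1 V1 acyclic])
  from D(3)[OF q(2) this] show ?thesis by simp
qed

lemma radical_and_decomposition_if_acyclic:
  assumes H1: "C \<noteq> {} \<Longrightarrow> (1, 1) \<in> H1" and V1: "C \<noteq> {} \<Longrightarrow> (1, 1) \<in> V1"
    and acyclic: "\<not> (\<exists>c. is_cycle (delete_verts (interval_graph C) {Inr V1, Inl H1}) c)"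
  shows "radical_ideal (minor_ring C) (minor_ideal C :: (vertex, 'k::field) mpoly set)"
    and "primary_decomposition (minor_ring C) (minor_ideal C :: (vertex, 'k) mpoly set)
      (minimal_admissible TYPE('k) C) (admissible_ideal C)"
proof -
  interpret cring "mpoly_ring verts :: (vertex, 'k) mpoly ring" by (rule cring_mpoly_ring)
  \<comment> \<open>The family whose intersection is I(C): \<open>{}\<close> contributes the toric
    ideal, the other members contribute ideals generated by variables.\<close>
  let ?A = "{W. admissible C W \<and> (W = {} \<or> (1, 1) \<in> W)}"
  let ?P = "admissible_ideal C :: _ \<Rightarrow> (vertex, 'k) mpoly set"
  have corner: "?P W = var_ideal verts W" if "admissible C W" "(1, 1) \<in> W" for W
    using that by (intro admissible_ideal_corner) (auto simp: admissible_def)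
  have prime: "primeideal (?P W) (mpoly_ring verts)" if "W \<in> ?A" for W
    using that corner[of W] primeideal_toric_ideal[of verts, where 'k = 'k]
      primeideal_var_ideal[of verts W, where 'k = 'k] by (auto simp: admissible_ideal_empty)
  have empty: "{} \<in> ?A" by (simp add: admissible_def)
  have "minor_ideal C \<subseteq> ?P W" if "W \<in> ?A" for W
    using that corner[of W] minor_ideal_subset_toric minor_ideal_subset_var_ideal[of W]
    by (auto simp: admissible_ideal_empty)
  then have sub: "minor_ideal C \<subseteq> carrier (mpoly_ring verts) \<inter> (\<Inter>W\<in>?A. ?P W)"
    using ideal_mpoly_ringD(1)[OF ideal_minor_ideal] by blast
  have "p \<in> minor_ideal C" if p: "p \<in> (\<Inter>W\<in>?A. ?P W)" for p
  proof (cases "C = {}")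
    case True
    have "p \<in> cycle_ideal C C"
      using p empty admissible_ideal_empty cycle_ideal_toric by blast
    then show ?thesis by (simp add: True cycle_ideal_def minor_ideal_def cycle_polys_empty)
  next
    case False
    have "p \<in> toric_ideal verts" using p empty admissible_ideal_empty by blast
    then show ?thesis
      using p corner by (intro mem_minor_ideal_if[OF H1 V1 acyclic] False) auto
  qed
  with sub have Inter: "carrier (mpoly_ring verts) \<inter> (\<Inter>W\<in>?A. ?P W) = minor_ideal C" by blast
  show "radical_ideal (minor_ring C) (minor_ideal C :: (vertex, 'k) mpoly set)"
    unfolding minor_ring_eq using prime Inter by (rule radical_ideal_Inter_primes)
  have fin: "finite {W. admissible C W}"
    by (rule finite_subset[of _ "Pow verts"]) (auto simp: admissible_def finite_verts)
  then have "finite ?A" by (rule rev_finite_subset) auto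
  then have "primary_decomposition (mpoly_ring verts) (minor_ideal C)
      {W \<in> {W. admissible C W}. minimal_prime (mpoly_ring verts) (minor_ideal C) (?P W)} ?P"
    by (intro primary_decomposition_minimal_primes[of ?A] prime Inter fin inj_on_admissible_ideal) auto
  then show "primary_decomposition (minor_ring C) (minor_ideal C :: (vertex, 'k) mpoly set)
      (minimal_admissible TYPE('k) C) (admissible_ideal C)"
    by (simp add: minimal_admissible_def minor_ring_eq)
qed

end

theorem corollary4p6:
  fixes m n :: nat and C :: "minor set" and H1 V1 :: "vertex set"
  assumes C_minors: "C \<subseteq> two_minors m n"
    and C_corner: "\<forall>d\<in>C. corner_minor d"
    and H1: "C \<noteq> {} \<Longrightarrow> H1 \<in> max_horizontal_intervals C \<and> (1, 1) \<in> H1"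
    and V1: "C \<noteq> {} \<Longrightarrow> V1 \<in> max_vertical_intervals C \<and> (1, 1) \<in> V1"
  shows "(radical_ideal (minor_ring C) (minor_ideal C :: (vertex, 'k::field) mpoly set) \<longleftrightarrow>
            \<not> (\<exists>c. is_cycle (delete_verts (interval_graph C) {Inr V1, Inl H1}) c)) \<and>
         (\<not> (\<exists>c. is_cycle (delete_verts (interval_graph C) {Inr V1, Inl H1}) c) \<longrightarrow>
            primary_decomposition (minor_ring C) (minor_ideal C :: (vertex, 'k) mpoly set)
              (minimal_admissible TYPE('k) C) (admissible_ideal C))"
proof -
  interpret corner_minors C m n using C_minors C_corner by unfold_locales
  \<comment> \<open>For \<open>C = {}\<close> nothing is known about \<open>H1\<close> and
    \<open>V1\<close>. The empty graph has no cycle for any deleted set, so the existence of a cycle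
    makes \<open>C\<close> nonempty and the hypotheses on the two intervals available.\<close>
  have empty: "\<not> is_cycle (delete_verts (interval_graph {}) X) c" for X c
  proof
    assume "is_cycle (delete_verts (interval_graph {}) X) c"
    then have "is_cycle (interval_graph {}) c" by (simp only: is_cycle_delete_verts)
    then have "3 \<le> length c \<and> set c \<subseteq> fst (interval_graph {})"
      unfolding is_cycle_def by (elim conjE) (intro conjI)
    moreover have "fst (interval_graph {}) = {}"
      by (auto simp: interval_graph_def max_horizontal_intervals_def max_vertical_intervals_def
          horizontal_interval_def vertical_interval_def verts_of_def)
    ultimately show False by auto
  qed
  show ?thesis
  proof (cases "\<exists>c. is_cycle (delete_verts (interval_graph C) {Inr V1, Inl H1}) c")
    case True
    then have "C \<noteq> {}" using empty by auto
    then have "\<not> radical_ideal (minor_ring C) (minor_ideal C :: (vertex, 'k) mpoly set)"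
      using True H1 V1 not_radical_if_cycle by blast
    with True show ?thesis by simp
  next
    case False
    then show ?thesis using radical_and_decomposition_if_acyclic[OF _ _ False, where 'k = 'k] H1 V1 by simp
  qed
qed

end
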